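(* Let $F\in\mathfrak F$, let $u\in W_1^1(-1,1)$ be non-negative with $u(-1)=u(1)=0$, and let $\mathfrak a:[-1,1]\times\mathbb R_+\to\mathbb R_+$ be a continuous function that is even and convex with respect to the first argument. Then $I(\mathfrak a,\overline u)\le I(\mathfrak a,u)$.
   Context: $\mathbb R_+=[0,\infty)$. $\mathfrak F$ is the set of continuous functions $F:\mathbb R_+\times\mathbb R_+\to\mathbb R_+$ that are convex and strictly increasing with respect to the second argument. For $F\in\mathfrak F$, a continuous weight $\mathfrak a:[-1,1]\times\mathbb R_+\to\mathbb R_+$ and a non-negative $u\in W_1^1(-1,1)$ (absolutely continuous functions on $[-1,1]$), $$I(\mathfrak a,u)=\int_{-1}^1 F\big(u(x),\mathfrak a(x,u(x))\,|u'(x)|\big)\,dx\in[0,\infty].$$ The symmetric rearrangement of a measurable set $E\subset[-1,1]$ is $\overline E=[-\tfrac{|E|}2,\tfrac{|E|}2]$, with $|E|$ the Lebesgue measure and $\overline\emptyset=\emptyset$. For non-negative $u$, with $\mathcal A_t=\{x\in[-1,1]:u(x)>t\}$, the symmetric rearrangement of $u$ is $\overline u(x)=\int_0^\infty\chi_{\overline{\mathcal A_t}}(x)\,dt$; it belongs to $W_1^1(-1,1)$. *)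

theory Defs
  imports "HOL-Analysis.Analysis"
begin

text \<open>
  Functions on \<open>[0,\<infinity>)\<close>, \<open>[-1,1]\<close> and their products are represented by total functions on the
  reals; every condition is imposed on the intended domain only, and values outside it do not
  influence any of the integrals below.
\<close>

definition abs_cont_on :: "real set \<Rightarrow> (real \<Rightarrow> real) \<Rightarrow> bool" where
  "abs_cont_on S u \<longleftrightarrow>
     (\<forall>\<epsilon>>0. \<exists>\<delta>>0. \<forall>(n::nat) l r.
        (\<forall>i<n. l i \<le> r i \<and> {l i..r i} \<subseteq> S) \<and>
        disjoint_family_on (\<lambda>i. {l i<..<r i}) {..<n} \<and>
        (\<Sum>i<n. r i - l i) < \<delta>
        \<longrightarrow> (\<Sum>i<n. \<bar>u (r i) - u (l i)\<bar>) < \<epsilon>)"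

text \<open>The Sobolev space \<open>W\<^sub>1\<^sup>1(-1,1)\<close>, each class being identified with its absolutely
  continuous representative on the closed interval.\<close>

definition W11 :: "(real \<Rightarrow> real) set" where
  "W11 = {u. abs_cont_on {-1..1} u}"

definition integrand_class :: "(real \<Rightarrow> real \<Rightarrow> real) set" where
  "integrand_class = {F.
     (\<forall>s\<ge>0. \<forall>p\<ge>0. F s p \<ge> 0) \<and>
     continuous_on ({0..} \<times> {0..}) (\<lambda>(s, p). F s p) \<and>
     (\<forall>s\<ge>0. convex_on {0..} (F s)) \<and>
     (\<forall>s\<ge>0. strict_mono_on {0..} (F s))}"

definition weight :: "(real \<Rightarrow> real \<Rightarrow> real) \<Rightarrow> bool" where
  "weight a \<longleftrightarrow>
     (\<forall>x\<in>{-1..1}. \<forall>t\<ge>0. a x t \<ge> 0) \<and>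
     continuous_on ({-1..1} \<times> {0..}) (\<lambda>(x, t). a x t)"

text \<open>For absolutely continuous \<open>u\<close> the derivative exists almost everywhere, so the unspecified
  values of \<open>deriv u\<close> elsewhere are irrelevant.  The value lies in \<open>[0,\<infinity>]\<close>.\<close>

definition energy ::
  "(real \<Rightarrow> real \<Rightarrow> real) \<Rightarrow> (real \<Rightarrow> real \<Rightarrow> real) \<Rightarrow> (real \<Rightarrow> real) \<Rightarrow> ennreal" where
  "energy F a u =
     (\<integral>\<^sup>+x\<in>{-1..1}. ennreal (F (u x) (a x (u x) * \<bar>deriv u x\<bar>)) \<partial>lebesgue)"

definition sym_set :: "real set \<Rightarrow> real set" where
  "sym_set E = (if E = {} then {} else {- (measure lebesgue E / 2)..measure lebesgue E / 2})"

definition superlevel :: "(real \<Rightarrow> real) \<Rightarrow> real \<Rightarrow> real set" where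
  "superlevel u t = {x \<in> {-1..1}. u x > t}"

definition sym_rearr :: "(real \<Rightarrow> real) \<Rightarrow> real \<Rightarrow> real" where
  "sym_rearr u x = (LINT t:{0..}|lebesgue. indicator (sym_set (superlevel u t)) x)"

end

theory Submission
  imports Defs
begin

text \<open>
  Write \<open>v\<close> for the rearrangement of \<open>u\<close>. It is even, non-increasing on \<open>[0,1]\<close>, and equimeasurable with
  \<open>u\<close>: integrals of functions of \<open>u x\<close> alone do not change when \<open>u\<close> is replaced by \<open>v\<close>. The proof
  reduces the inequality to an integrand that is linear in the gradient, by means of subgradients, and
  proves the linear case level by level.

  Almost everywhere \<open>|v'|\<close> is a Borel function \<open>slope\<close> of the level \<open>v x\<close> (\<open>slope_ae\<close>), and on the
  levels where it does not vanish the point \<open>x\<close> is recovered from the level as \<open>\<plusminus> m t / 2\<close>, where \<open>m\<close> is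
  the distribution function. Hence \<open>a x (v x) * |v' x| = P (v x)\<close> for a function \<open>P\<close> of the level. If \<open>\<lambda> t\<close>
  is a subgradient of the convex function \<open>F t\<close> at \<open>P t\<close>, then
  \<open>F t p \<ge> F t (P t) + \<lambda> t * (p - P t)\<close>. Inserting \<open>t = u x\<close> and \<open>p = a x (u x) * |u' x|\<close> and integrating,
  the first term gives the energy of \<open>v\<close> by equimeasurability. It remains to see that the last
  term contributes a non-negative amount, which is the linear case with the weight \<open>\<lambda>\<close>
  (\<open>linear_comparison\<close>).

  For the linear case both sides become integrals over the levels. On the side of \<open>v\<close> the change of
  variables \<open>t = v x\<close> on the points of strict descent yields at most twice the integral of
  \<open>\<lambda> t * a (m t / 2) t\<close> (\<open>slope_integral\<close>). On the side of \<open>u\<close> it suffices to integrate over the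
  first and the last point \<open>l\<close> and \<open>r\<close> of each level, which gives at least the integral of
  \<open>\<lambda> t * (a l t + a r t)\<close> (\<open>hits_integral\<close>). Since the superlevel set lies between \<open>l\<close> and \<open>r\<close>, one has
  \<open>m t \<le> r - l\<close>, and as \<open>a\<close> is even and convex in its first argument,
  \<open>2 a(m t / 2) \<le> 2 a((r - l) / 2) \<le> a(r) + a(- l) = a(r) + a(l)\<close> (\<open>weight_at_hits\<close>).

  Two facts of real analysis carry this. Monotone functions are differentiable almost
  everywhere (\<open>mono_differentiable_ae\<close>, from the Vitali covering theorem); this gives derivatives of
  \<open>v\<close>, and of \<open>u\<close> because an absolutely continuous function is a difference of monotone ones.
  Absolutely continuous functions map null sets to null sets (\<open>abs_cont_on_negligible_image\<close>), so that
  almost every level of \<open>u\<close> has first and last points at which \<open>u\<close> is differentiable.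
\<close>

section \<open>Differentiability of monotone functions almost everywhere\<close>

text \<open>
  The form of the Vitali covering theorem used below: intervals need not be centred at the points
  that they cover, and they may be kept inside any open set containing the covered set.
\<close>

lemma interval_Vitali:
  fixes E U :: "real set"
  assumes "open U" "E \<subseteq> U"
    and fine: "\<And>x d. x \<in> E \<Longrightarrow> 0 < d \<Longrightarrow> \<exists>c e. Q c e \<and> c < e \<and> x \<in> {c..e} \<and> e - c < d"
  obtains C where "countable C" "\<And>c e. (c,e) \<in> C \<Longrightarrow> c < e \<and> Q c e \<and> {c..e} \<subseteq> U"
    "disjoint_family_on (\<lambda>(c,e). {c..e}) C" "negligible (E - (\<Union>(c,e)\<in>C. {c..e}))"
proof -
  define K where "K = {(c,e). c < e \<and> Q c e \<and> {c..e} \<subseteq> U}"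
  define mid where "mid = (\<lambda>(c::real,e). (c + e) / 2)"
  define rad where "rad = (\<lambda>(c::real,e). (e - c) / 2)"
  have cb: "cball (mid i) (rad i) = (\<lambda>(c,e). {c..e}) i" for i
    by (cases i) (auto simp: mid_def rad_def cball_eq_atLeastAtMost field_simps)
  obtain C where C: "countable C" "C \<subseteq> K"
     "pairwise (\<lambda>i j. disjnt (cball (mid i) (rad i)) (cball (mid j) (rad j))) C"
     "negligible (E - (\<Union>i\<in>C. cball (mid i) (rad i)))"
  proof (rule Vitali_covering_theorem_cballs[of K rad E mid])
    show "\<And>i. i \<in> K \<Longrightarrow> 0 < rad i" by (auto simp: K_def rad_def)
    fix x d :: real
    assume x: "x \<in> E" and d: "0 < d"
    obtain r where r: "r > 0" "ball x r \<subseteq> U"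
      using assms x by (meson openE subsetD)
    obtain c e where ce: "Q c e" "c < e" "x \<in> {c..e}" "e - c < min d r"
      using fine[OF x, of "min d r"] d r by auto
    have "{c..e} \<subseteq> ball x r" using ce by (auto simp: dist_real_def)
    then have "(c,e) \<in> K" using ce r unfolding K_def by auto
    then show "\<exists>i. i \<in> K \<and> x \<in> cball (mid i) (rad i) \<and> rad i < d"
      by (intro exI[of _ "(c,e)"], unfold cb) (use ce in \<open>auto simp: rad_def\<close>)
  qed
  show thesis
  proof (rule that[OF C(1)])
    show "disjoint_family_on (\<lambda>(c,e). {c..e}) C"
      using C(3) unfolding cb disjoint_family_on_def pairwise_def disjnt_def by blast
    show "negligible (E - (\<Union>(c,e)\<in>C. {c..e}))" using C(4) unfolding cb .
  qed (use C(2) in \<open>auto simp: K_def\<close>)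
qed

text \<open>
  A monotone \<open>g\<close> may jump, so the images of disjoint intervals are replaced by the open intervals
  between the values of \<open>g\<close> at the end points. Their disjointness turns sums of increments of \<open>g\<close>
  into Lebesgue measures.
\<close>

lemma image_gaps_disjoint:
  fixes g :: "real \<Rightarrow> real"
  assumes "mono g" "\<And>c e. (c,e) \<in> C \<Longrightarrow> c < e" "disjoint_family_on (\<lambda>(c,e). {c..e}) C"
  shows "disjoint_family_on (\<lambda>(c,e). {g c<..<g e}) C"
proof -
  have "{g c<..<g e} \<inter> {g c'<..<g e'} = {}"
    if "(c,e) \<in> C" "(c',e') \<in> C" "(c,e) \<noteq> (c',e')" for c e c' e'
  proof -
    have "{c..e} \<inter> {c'..e'} = {}"
      using assms(3) that unfolding disjoint_family_on_def by fastforce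
    then have "e < c' \<or> e' < c" using assms(2)[OF that(1)] assms(2)[OF that(2)]
      by (smt (verit) Int_iff atLeastAtMost_iff empty_iff)
    then have "g e \<le> g c' \<or> g e' \<le> g c" using monoD[OF assms(1)] by (meson less_imp_le)
    then show ?thesis by auto
  qed
  then show ?thesis unfolding disjoint_family_on_def by blast
qed

text \<open>
  Points near which \<open>g\<close> increases at rate at least \<open>q\<close> cost at least \<open>q\<close> times their length in
  range: the Vitali intervals have total length at most \<open>1/q\<close> times the total length of
  the gaps in the range, and these gaps are disjoint subsets of \<open>W\<close>.
\<close>

lemma steep_cover:
  fixes g :: "real \<Rightarrow> real"
  assumes "mono g" "q > 0" "open U" "E \<subseteq> U"
    and fine: "\<And>x d. x \<in> E \<Longrightarrow> 0 < d \<Longrightarrow> \<exists>c e. q * (e - c) \<le> g e - g c \<and> c < e \<and> x \<in> {c..e} \<and> e - c < d"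
    and W: "W \<in> sets lebesgue" "\<And>c e. c < e \<Longrightarrow> {c..e} \<subseteq> U \<Longrightarrow> {g c<..<g e} \<subseteq> W"
  shows "\<exists>T\<in>sets lebesgue. E \<subseteq> T \<and> ennreal q * emeasure lebesgue T \<le> emeasure lebesgue W"
proof -
  obtain C where C: "countable C" "\<And>c e. (c,e) \<in> C \<Longrightarrow> c < e \<and> q * (e - c) \<le> g e - g c \<and> {c..e} \<subseteq> U"
    "disjoint_family_on (\<lambda>(c,e). {c..e}) C" "negligible (E - (\<Union>(c,e)\<in>C. {c..e}))"
    by (rule interval_Vitali[OF assms(3,4), of "\<lambda>c e. q * (e - c) \<le> g e - g c"]) (use fine in blast)+
  define T where "T = (\<Union>(c,e)\<in>C. {c..e}) \<union> (E - (\<Union>(c,e)\<in>C. {c..e}))"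
  have N: "(E - (\<Union>(c,e)\<in>C. {c..e})) \<in> null_sets lebesgue"
    using C(4) negligible_iff_null_sets by blast
  have m1: "(\<Union>(c,e)\<in>C. {c..e}) \<in> sets lebesgue"
    using C(1) by (intro sets.countable_UN'') auto
  have "emeasure lebesgue T = emeasure lebesgue (\<Union>(c,e)\<in>C. {c..e})"
    unfolding T_def by (rule emeasure_Un_null_set[OF m1 N])
  also have "\<dots> = (\<integral>\<^sup>+i. emeasure lebesgue ((\<lambda>(c,e). {c..e}) i) \<partial>count_space C)"
    by (rule emeasure_UN_countable) (use C in auto)
  also have "ennreal q * \<dots> = (\<integral>\<^sup>+i. ennreal q * emeasure lebesgue ((\<lambda>(c,e). {c..e}) i) \<partial>count_space C)"
    by (rule nn_integral_cmult[symmetric]) auto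
  also have "\<dots> \<le> (\<integral>\<^sup>+i. emeasure lebesgue ((\<lambda>(c,e). {g c<..<g e}) i) \<partial>count_space C)"
  proof (rule nn_integral_mono, clarsimp)
    fix c e assume "(c,e) \<in> C"
    from C(2)[OF this] \<open>q > 0\<close> have "c < e" "q * (e - c) \<le> g e - g c" "g c \<le> g e"
      using monoD[OF assms(1), of c e] by auto
    then show "ennreal q * emeasure lborel {c..e} \<le> emeasure lborel {g c<..<g e}"
      using \<open>q > 0\<close> by (simp flip: ennreal_mult)
  qed
  also have "\<dots> = emeasure lebesgue (\<Union>(c,e)\<in>C. {g c<..<g e})"
    by (rule emeasure_UN_countable[symmetric]) (use C image_gaps_disjoint[OF assms(1) _ C(3)] in auto)
  also have "\<dots> \<le> emeasure lebesgue W"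
    by (rule emeasure_mono) (use C(2) W in fastforce)+
  finally show ?thesis
    by (intro bexI[of _ T] conjI) (use sets.Un[OF m1 null_setsD2[OF N]] in \<open>auto simp: T_def\<close>)
qed

text \<open>
  The opposite estimate. The set \<open>V\<close> is the union of the interiors of the Vitali intervals and \<open>W\<close>
  is the union of the corresponding gaps in the range. The last clause is in the form that
  \<open>steep_cover\<close> needs in order to be applied inside \<open>V\<close>; it holds because the closed Vitali
  intervals are disjoint, so that an interval contained in \<open>V\<close> lies in one of them.
\<close>

lemma flat_cover:
  fixes g :: "real \<Rightarrow> real"
  assumes "mono g" "p > 0" "open U" "E \<subseteq> U"
    and fine: "\<And>x d. x \<in> E \<Longrightarrow> 0 < d \<Longrightarrow> \<exists>c e. g e - g c \<le> p * (e - c) \<and> c < e \<and> x \<in> {c..e} \<and> e - c < d"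
  shows "\<exists>V W. open V \<and> open W \<and> negligible (E - V) \<and>
      emeasure lebesgue W \<le> ennreal p * emeasure lebesgue U \<and>
      (\<forall>c e. c < e \<longrightarrow> {c..e} \<subseteq> V \<longrightarrow> {g c<..<g e} \<subseteq> W)"
proof -
  obtain C where C: "countable C" "\<And>c e. (c,e) \<in> C \<Longrightarrow> c < e \<and> g e - g c \<le> p * (e - c) \<and> {c..e} \<subseteq> U"
    "disjoint_family_on (\<lambda>(c,e). {c..e}) C" "negligible (E - (\<Union>(c,e)\<in>C. {c..e}))"
    by (rule interval_Vitali[OF assms(3,4), of "\<lambda>c e. g e - g c \<le> p * (e - c)"]) (use fine in blast)+
  define V where "V = (\<Union>(c,e)\<in>C. {c<..<e})"
  define W where "W = (\<Union>(c,e)\<in>C. {g c<..<g e})"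
  have "open V" "open W" unfolding V_def W_def by auto
  moreover have "negligible (E - V)"
  proof (rule negligible_subset)
    have "negligible (\<Union>(c,e)\<in>C. {c,e})"
      using C(1) by (intro iffD2[OF negligible_iff_null_sets] null_sets_completionI countable_imp_null_set_lborel countable_UN) auto
    then show "negligible ((E - (\<Union>(c,e)\<in>C. {c..e})) \<union> (\<Union>(c,e)\<in>C. {c,e}))"
      using C(4) negligible_Un by blast
    show "E - V \<subseteq> (E - (\<Union>(c,e)\<in>C. {c..e})) \<union> (\<Union>(c,e)\<in>C. {c,e})"
      unfolding V_def
    proof
      fix x assume x: "x \<in> E - (\<Union>(c,e)\<in>C. {c<..<e})"
      show "x \<in> (E - (\<Union>(c,e)\<in>C. {c..e})) \<union> (\<Union>(c,e)\<in>C. {c,e})"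
      proof (cases "\<exists>c e. (c,e) \<in> C \<and> x \<in> {c..e}")
        case True
        then obtain c e where ce: "(c,e) \<in> C" "x \<in> {c..e}" by blast
        with x have "x \<notin> {c<..<e}" by blast
        with ce(2) have "x \<in> {c,e}" by auto
        with ce(1) show ?thesis by blast
      qed (use x in auto)
    qed
  qed
  moreover have "emeasure lebesgue W \<le> ennreal p * emeasure lebesgue U"
  proof -
    have "emeasure lebesgue W = (\<integral>\<^sup>+i. emeasure lebesgue ((\<lambda>(c,e). {g c<..<g e}) i) \<partial>count_space C)"
      unfolding W_def
      by (rule emeasure_UN_countable) (use C image_gaps_disjoint[OF assms(1) _ C(3)] in auto)
    also have "\<dots> \<le> (\<integral>\<^sup>+i. ennreal p * emeasure lebesgue ((\<lambda>(c,e). {c..e}) i) \<partial>count_space C)"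
    proof (rule nn_integral_mono, clarsimp)
      fix c e assume "(c,e) \<in> C"
      from C(2)[OF this] \<open>p > 0\<close> have "c < e" "g e - g c \<le> p * (e - c)" "g c \<le> g e"
        using monoD[OF assms(1), of c e] by auto
      then show "emeasure lborel {g c<..<g e} \<le> ennreal p * emeasure lborel {c..e}"
        using \<open>p > 0\<close> by (simp flip: ennreal_mult)
    qed
    also have "\<dots> = ennreal p * (\<integral>\<^sup>+i. emeasure lebesgue ((\<lambda>(c,e). {c..e}) i) \<partial>count_space C)"
      by (rule nn_integral_cmult) auto
    also have "(\<integral>\<^sup>+i. emeasure lebesgue ((\<lambda>(c,e). {c..e}) i) \<partial>count_space C) = emeasure lebesgue (\<Union>(c,e)\<in>C. {c..e})"
      by (rule emeasure_UN_countable[symmetric]) (use C in auto)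
    also have "\<dots> \<le> emeasure lebesgue U"
      by (rule emeasure_mono) (use C(2) assms(3) in auto)
    finally show ?thesis by (simp add: mult_left_mono)
  qed
  moreover have "{g c<..<g e} \<subseteq> W" if "c < e" "{c..e} \<subseteq> V" for c e
  proof -
    have "c \<in> V" using that by auto
    then obtain c1 e1 where 1: "(c1,e1) \<in> C" "c1 < c" "c < e1" unfolding V_def by auto
    have "e < e1"
    proof (rule ccontr)
      assume "\<not> e < e1"
      then have "e1 \<in> V" using that 1 by auto
      then obtain c2 e2 where 2: "(c2,e2) \<in> C" "c2 < e1" "e1 < e2" unfolding V_def by auto
      then have "(c1,e1) \<noteq> (c2,e2)" by auto
      then have "{c1..e1} \<inter> {c2..e2} = {}"
        using disjoint_family_onD[OF C(3) 1(1) 2(1)] by simp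
      moreover have "e1 \<in> {c1..e1} \<inter> {c2..e2}" using 1 2 by auto
      ultimately show False by blast
    qed
    then have "g c1 \<le> g c" "g e \<le> g e1" using 1 monoD[OF assms(1)] by (auto simp: less_imp_le)
    then have "{g c<..<g e} \<subseteq> {g c1<..<g e1}" by auto
    then show ?thesis unfolding W_def using 1(1) by auto
  qed
  ultimately show ?thesis by blast
qed

text \<open>
  The infimum of the measures of the open supersets of \<open>E\<close> satisfies \<open>s \<le> \<theta> s\<close>, by outer
  regularity of Lebesgue measure, and it is finite, so it vanishes.
\<close>

lemma negligible_contraction:
  fixes E :: "real set"
  assumes "E \<subseteq> {a<..<b}" "0 \<le> \<theta>" "\<theta> < 1"
    and "\<And>U. open U \<Longrightarrow> E \<subseteq> U \<Longrightarrow> \<exists>T\<in>sets lebesgue. E \<subseteq> T \<and> emeasure lebesgue T \<le> ennreal \<theta> * emeasure lebesgue U"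
  shows "negligible E"
proof -
  define \<U> where "\<U> = {U. open U \<and> E \<subseteq> U}"
  define s where "s = (INF U\<in>\<U>. emeasure lebesgue U)"
  have step: "s \<le> ennreal \<theta> * emeasure lebesgue U" if UU: "U \<in> \<U>" for U
  proof -
    obtain T where T: "T \<in> sets lebesgue" "E \<subseteq> T" "emeasure lebesgue T \<le> ennreal \<theta> * emeasure lebesgue U"
      using assms(4)[of U] UU unfolding \<U>_def by blast
    have "s \<le> emeasure lebesgue T + ennreal \<epsilon>" if "\<epsilon> > 0" for \<epsilon>
    proof -
      obtain U' where U': "open U'" "T \<subseteq> U'" "U' - T \<in> lmeasurable" "emeasure lebesgue (U' - T) < ennreal \<epsilon>"
        by (rule sets_lebesgue_outer_open[OF T(1) \<open>\<epsilon> > 0\<close>])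
      have "s \<le> emeasure lebesgue U'"
        unfolding s_def by (rule INF_lower) (use U'(1,2) T(2) in \<open>auto simp: \<U>_def\<close>)
      also have "\<dots> = emeasure lebesgue (T \<union> (U' - T))"
        by (rule arg_cong[of _ _ "emeasure lebesgue"]) (use U'(2) in blast)
      also have "\<dots> \<le> emeasure lebesgue T + emeasure lebesgue (U' - T)"
        by (rule emeasure_subadditive) (use T(1) fmeasurableD[OF U'(3)] in simp_all)
      also have "\<dots> \<le> emeasure lebesgue T + ennreal \<epsilon>" by (rule add_left_mono[OF less_imp_le[OF U'(4)]])
      finally show ?thesis .
    qed
    then have "s \<le> emeasure lebesgue T"
      by (rule ennreal_le_epsilon)
    then show ?thesis using T(3) by (rule order_trans)
  qed
  have "s \<le> emeasure lebesgue {a<..<b}"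
    unfolding s_def by (rule INF_lower) (use assms(1) in \<open>auto simp: \<U>_def\<close>)
  also have "\<dots> < \<infinity>" using emeasure_lborel_box_finite[of a b] by simp
  finally have fin: "s < \<infinity>" .
  have "s = 0"
  proof (rule ccontr)
    assume "s \<noteq> 0"
    obtain r where r: "s = ennreal r" "r > 0"
      using fin \<open>s \<noteq> 0\<close> by (cases s) (auto simp: less_eq_real_def)
    \<comment> \<open>The slack is \<open>(1 - \<theta>) r\<close> because \<open>\<theta> (r + (1 - \<theta>) r) = r - (1 - \<theta>)\<^sup>2 r\<close>.\<close>
    have "s < ennreal (r + (1 - \<theta>) * r)" using r assms(3) by (simp add: ennreal_lessI)
    then obtain U where U: "U \<in> \<U>" "emeasure lebesgue U < ennreal (r + (1 - \<theta>) * r)"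
      unfolding s_def INF_less_iff by blast
    have "ennreal r \<le> ennreal \<theta> * ennreal (r + (1 - \<theta>) * r)"
      using step[OF U(1)] mult_left_mono[OF less_imp_le[OF U(2)], of "ennreal \<theta>"] r(1) by simp
    then have "ennreal r \<le> ennreal (\<theta> * (r + (1 - \<theta>) * r))"
      using r assms(2,3) by (subst ennreal_mult) auto
    then have "r \<le> \<theta> * (r + (1 - \<theta>) * r)"
      using r assms(2,3) by (simp add: ennreal_le_iff)
    then have "r * (1 - \<theta>)\<^sup>2 \<le> 0" by (simp add: power2_eq_square algebra_simps)
    then show False using r(2) assms(3) by (simp add: mult_le_0_iff)
  qed
  show ?thesis
    unfolding negligible_outer_le
  proof (intro allI impI)
    fix e :: real assume "e > 0"
    then have "(INF U\<in>\<U>. emeasure lebesgue U) < ennreal e"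
      using \<open>s = 0\<close> unfolding s_def by simp
    then obtain U where U: "U \<in> \<U>" "emeasure lebesgue U < ennreal e"
      unfolding INF_less_iff by blast
    then have "U \<in> lmeasurable"
      by (intro fmeasurableI) (auto simp: \<U>_def intro: less_trans)
    moreover have "measure lebesgue U \<le> e"
      using U(2) \<open>e > 0\<close> emeasure_eq_measure2[OF calculation] by (simp add: ennreal_less_iff less_imp_le)
    ultimately show "\<exists>T. E \<subseteq> T \<and> T \<in> lmeasurable \<and> measure lebesgue T \<le> e"
      using U unfolding \<U>_def by auto
  qed
qed


text \<open>
  These two predicates speak of intervals that contain \<open>x\<close>, not of difference quotients at \<open>x\<close>, since this is
  what a covering argument uses. A difference quotient at \<open>x\<close> is the slope over an interval with
  end point \<open>x\<close>.
\<close>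

definition steep_at :: "(real \<Rightarrow> real) \<Rightarrow> real \<Rightarrow> real \<Rightarrow> bool" where
  "steep_at g q x \<longleftrightarrow> (\<forall>d>0. \<exists>c e. q * (e - c) \<le> g e - g c \<and> c < e \<and> x \<in> {c..e} \<and> e - c < d)"

definition flat_at :: "(real \<Rightarrow> real) \<Rightarrow> real \<Rightarrow> real \<Rightarrow> bool" where
  "flat_at g p x \<longleftrightarrow> (\<forall>d>0. \<exists>c e. g e - g c \<le> p * (e - c) \<and> c < e \<and> x \<in> {c..e} \<and> e - c < d)"

text \<open>
  Inside an open set \<open>U\<close>, flatness confines the points to a set whose range has measure at most
  \<open>p |U|\<close>, and steepness then confines them to a set of measure at most \<open>(p/q) |U|\<close>. Hence
  \<open>negligible_contraction\<close> applies with the ratio \<open>p/q\<close>.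
\<close>

lemma negligible_oscillating:
  fixes g :: "real \<Rightarrow> real"
  assumes "mono g" "0 < p" "p < q"
  shows "negligible {x\<in>{a<..<b}. flat_at g p x \<and> steep_at g q x}" (is "negligible ?E")
proof (rule negligible_contraction[of _ a b "p / q"])
  fix U :: "real set" assume U: "open U" "?E \<subseteq> U"
  obtain V W where VW: "open V" "open W" "negligible (?E - V)"
      "emeasure lebesgue W \<le> ennreal p * emeasure lebesgue U"
      "\<And>c e. c < e \<Longrightarrow> {c..e} \<subseteq> V \<Longrightarrow> {g c<..<g e} \<subseteq> W"
    using flat_cover[OF assms(1,2) U] unfolding flat_at_def by blast
  obtain T where T: "T \<in> sets lebesgue" "?E \<inter> V \<subseteq> T" "ennreal q * emeasure lebesgue T \<le> emeasure lebesgue W"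
    using steep_cover[OF assms(1) _ VW(1), of q "?E \<inter> V" W] VW(2,5) assms unfolding steep_at_def
    by (auto simp: Bex_def)
  have N: "?E - V \<in> null_sets lebesgue" using VW(3) negligible_iff_null_sets by blast
  have "emeasure lebesgue T = ennreal (1 / q) * (ennreal q * emeasure lebesgue T)"
    using assms by (simp flip: ennreal_mult mult.assoc)
  also have "\<dots> \<le> ennreal (1 / q) * (ennreal p * emeasure lebesgue U)"
    by (intro mult_left_mono order_trans[OF T(3) VW(4)]) auto
  also have "\<dots> = ennreal (p / q) * emeasure lebesgue U"
    using assms by (simp flip: ennreal_mult mult.assoc)
  finally have "emeasure lebesgue (T \<union> (?E - V)) \<le> ennreal (p / q) * emeasure lebesgue U"
    using emeasure_Un_null_set[OF T(1) N] by simp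
  then show "\<exists>T\<in>sets lebesgue. ?E \<subseteq> T \<and> emeasure lebesgue T \<le> ennreal (p / q) * emeasure lebesgue U"
    using T(2) sets.Un[OF T(1) null_setsD2[OF N]] by (intro bexI[of _ "T \<union> (?E - V)"]) auto
qed (use assms in auto)

text \<open>
  If the slopes at \<open>x\<close> are unbounded, \<open>steep_cover\<close> applies with every \<open>q\<close>, while the range
  available is the fixed interval from \<open>g a\<close> to \<open>g b\<close>.
\<close>

lemma negligible_vertical:
  fixes g :: "real \<Rightarrow> real"
  assumes "mono g"
  shows "negligible {x\<in>{a<..<b}. \<forall>q>0. steep_at g q x}" (is "negligible ?E")
  unfolding negligible_outer_le
proof (intro allI impI)
  fix \<epsilon> :: real assume "\<epsilon> > 0"
  define q where "q = (\<bar>g b - g a\<bar> + 1) / \<epsilon>"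
  have q: "q > 0" using \<open>\<epsilon> > 0\<close> by (simp add: q_def add_nonneg_pos)
  have sub: "{g c<..<g e} \<subseteq> {g a<..<g b}" if "c < e" "{c..e} \<subseteq> {a<..<b}" for c e
  proof -
    have "c \<in> {c..e}" "e \<in> {c..e}" using that by auto
    then have "a \<le> c" "e \<le> b" using that(2) by fastforce+
    then have "g a \<le> g c" "g e \<le> g b" using monoD[OF assms] by auto
    then show ?thesis by auto
  qed
  have "\<exists>T\<in>sets lebesgue. ?E \<subseteq> T \<and> ennreal q * emeasure lebesgue T \<le> emeasure lebesgue {g a<..<g b}"
    by (rule steep_cover[OF assms q, of "{a<..<b}"]) (use sub q in \<open>auto simp: steep_at_def\<close>)
  then obtain T where T: "T \<in> sets lebesgue" "?E \<subseteq> T"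
      "ennreal q * emeasure lebesgue T \<le> emeasure lebesgue {g a<..<g b}"
    by blast
  have "emeasure lebesgue T = ennreal (1 / q) * (ennreal q * emeasure lebesgue T)"
    using q by (simp flip: ennreal_mult mult.assoc)
  also have "\<dots> \<le> ennreal (1 / q) * ennreal (\<bar>g b - g a\<bar> + 1)"
  proof (intro mult_left_mono order_trans[OF T(3)])
    show "emeasure lebesgue {g a<..<g b} \<le> ennreal (\<bar>g b - g a\<bar> + 1)"
      by (cases "g a \<le> g b") (auto intro!: ennreal_leI)
  qed auto
  also have "\<dots> = ennreal (1 / q * (\<bar>g b - g a\<bar> + 1))"
    using q by (subst ennreal_mult) auto
  also have "1 / q * (\<bar>g b - g a\<bar> + 1) = \<epsilon>"
    using \<open>\<epsilon> > 0\<close> by (simp add: q_def add_nonneg_pos)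
  finally have le: "emeasure lebesgue T \<le> ennreal \<epsilon>" .
  then have "T \<in> lmeasurable" using T(1) by (intro fmeasurableI) (auto simp: le_less_trans)
  moreover have "measure lebesgue T \<le> \<epsilon>"
    using le \<open>\<epsilon> > 0\<close> emeasure_eq_measure2[OF calculation] by simp
  ultimately show "\<exists>T. ?E \<subseteq> T \<and> T \<in> lmeasurable \<and> measure lebesgue T \<le> \<epsilon>"
    using T(2) by blast
qed

lemma slope_interval:
  fixes g :: "real \<Rightarrow> real"
  assumes "y \<noteq> x"
  shows "\<exists>c e. c < e \<and> x \<in> {c..e} \<and> e - c = dist y x \<and> g e - g c = (g y - g x) / (y - x) * (e - c)"
proof (cases "x < y")
  case True
  then show ?thesis by (intro exI[of _ x] exI[of _ y]) (auto simp: dist_real_def)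
next
  case False
  with assms have "y < x" by simp
  then show ?thesis
    by (intro exI[of _ y] exI[of _ x]) (auto simp: dist_real_def field_simps)
qed

lemma steep_at_frequently:
  assumes "\<exists>\<^sub>F y in at x. q \<le> (g y - g x) / (y - x)"
  shows "steep_at g q x"
  unfolding steep_at_def
proof (intro allI impI)
  fix d :: real assume "d > 0"
  then have "\<forall>\<^sub>F y in at x. y \<noteq> x \<and> dist y x < d" by (auto simp: eventually_at)
  with assms have "\<exists>\<^sub>F y in at x. q \<le> (g y - g x) / (y - x) \<and> y \<noteq> x \<and> dist y x < d"
    by (rule frequently_eventually_frequently)
  then obtain y where y: "q \<le> (g y - g x) / (y - x)" "y \<noteq> x" "dist y x < d"
    using frequently_ex by force
  obtain c e where ce: "c < e" "x \<in> {c..e}" "e - c = dist y x" "g e - g c = (g y - g x) / (y - x) * (e - c)"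
    using slope_interval[OF y(2), of g] by blast
  have "q * (e - c) \<le> (g y - g x) / (y - x) * (e - c)"
    using y(1) ce(1) by (intro mult_right_mono) auto
  then show "\<exists>c e. q * (e - c) \<le> g e - g c \<and> c < e \<and> x \<in> {c..e} \<and> e - c < d"
    using ce y(3) by (intro exI[of _ c] exI[of _ e]) auto
qed

lemma flat_at_frequently:
  assumes "\<exists>\<^sub>F y in at x. (g y - g x) / (y - x) \<le> p"
  shows "flat_at g p x"
  unfolding flat_at_def
proof (intro allI impI)
  fix d :: real assume "d > 0"
  then have "\<forall>\<^sub>F y in at x. y \<noteq> x \<and> dist y x < d" by (auto simp: eventually_at)
  with assms have "\<exists>\<^sub>F y in at x. (g y - g x) / (y - x) \<le> p \<and> y \<noteq> x \<and> dist y x < d"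
    by (rule frequently_eventually_frequently)
  then obtain y where y: "(g y - g x) / (y - x) \<le> p" "y \<noteq> x" "dist y x < d"
    using frequently_ex by force
  obtain c e where ce: "c < e" "x \<in> {c..e}" "e - c = dist y x" "g e - g c = (g y - g x) / (y - x) * (e - c)"
    using slope_interval[OF y(2), of g] by blast
  have "(g y - g x) / (y - x) * (e - c) \<le> p * (e - c)"
    using y(1) ce(1) by (intro mult_right_mono) auto
  then show "\<exists>c e. g e - g c \<le> p * (e - c) \<and> c < e \<and> x \<in> {c..e} \<and> e - c < d"
    using ce y(3) by (intro exI[of _ c] exI[of _ e]) auto
qed

text \<open>
  The lower and upper limits of the difference quotient at \<open>x\<close> are non-negative by monotonicity.
  Either they agree and are finite, or the upper limit is infinite, or two positive rational
  numbers fit strictly between them.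
\<close>

lemma differentiable_or_oscillating:
  fixes g :: "real \<Rightarrow> real"
  assumes "mono g"
  shows "g differentiable at x \<or> (\<forall>q>0. steep_at g q x) \<or>
    (\<exists>p\<in>\<rat>. \<exists>q\<in>\<rat>. 0 < p \<and> p < q \<and> flat_at g p x \<and> steep_at g q x)"
proof -
  define s where "s = (\<lambda>y. (g y - g x) / (y - x))"
  define L where "L = Liminf (at x) (\<lambda>y. ereal (s y))"
  define H where "H = Limsup (at x) (\<lambda>y. ereal (s y))"
  have s0: "0 \<le> s y" for y
    using monoD[OF assms, of x y] monoD[OF assms, of y x]
    by (cases "x \<le> y") (auto simp: s_def zero_le_divide_iff)
  have L0: "0 \<le> L" unfolding L_def by (rule Liminf_bounded) (simp add: s0)
  have LH: "L \<le> H" unfolding L_def H_def by (rule Liminf_le_Limsup) simp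
  have steep: "steep_at g q x" if "ereal q < H" for q
  proof (rule steep_at_frequently, rule ccontr)
    assume "\<not> (\<exists>\<^sub>F y in at x. q \<le> (g y - g x) / (y - x))"
    then have "\<forall>\<^sub>F y in at x. s y \<le> q" unfolding s_def not_frequently by (rule eventually_mono) auto
    then have "H \<le> ereal q" unfolding H_def by (intro Limsup_bounded) (auto elim: eventually_mono)
    with that show False by simp
  qed
  have flat: "flat_at g p x" if "L < ereal p" for p
  proof (rule flat_at_frequently, rule ccontr)
    assume "\<not> (\<exists>\<^sub>F y in at x. (g y - g x) / (y - x) \<le> p)"
    then have "\<forall>\<^sub>F y in at x. p \<le> s y" unfolding s_def not_frequently by (rule eventually_mono) auto
    then have "ereal p \<le> L" unfolding L_def by (intro Liminf_bounded) (auto elim: eventually_mono)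
    with that show False by simp
  qed
  consider "H = \<infinity>" | "L = H" "H \<noteq> \<infinity>" | "L < H" using LH by force
  then show ?thesis
  proof cases
    case 1
    then show ?thesis using steep by simp
  next
    case 2
    obtain D where D: "H = ereal D" using 2 L0 by (cases H) auto
    have "((\<lambda>y. ereal (s y)) \<longlongrightarrow> ereal D) (at x)"
      using 2 D unfolding L_def H_def by (subst tendsto_iff_Liminf_eq_Limsup) auto
    then have "(s \<longlongrightarrow> D) (at x)" by simp
    then have "(g has_field_derivative D) (at x)" by (simp add: has_field_derivative_iff s_def)
    then show ?thesis using real_differentiable_def by blast
  next
    case 3
    then obtain l h where lh: "L < ereal l" "l < h" "ereal h < H"
      using ereal_dense2[of L H] ereal_dense2 by (metis less_ereal.simps(1))
    obtain q where q: "q \<in> \<rat>" "l < q" "q < h" using Rats_dense_in_real[OF lh(2)] by blast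
    obtain p where p: "p \<in> \<rat>" "l < p" "p < q" using Rats_dense_in_real[OF q(2)] by blast
    have Lp: "L < ereal p" and qH: "ereal q < H"
      using less_trans[OF lh(1), of "ereal p"] less_trans[OF _ lh(3), of "ereal q"] p q by auto
    have "0 < p" using Lp L0 by (metis ereal_less(2) le_less_trans)
    then show ?thesis using p q flat[OF Lp] steep[OF qH] by auto
  qed
qed

text \<open>
  Lebesgue's differentiation theorem for monotone functions.
\<close>

lemma mono_differentiable_ae:
  fixes g :: "real \<Rightarrow> real"
  assumes "mono g"
  shows "negligible {x. \<not> g differentiable at x}"
proof -
  \<comment> \<open>The intersection with bounded intervals makes the infimum in the contraction argument finite.\<close>
  define B where "B = (\<lambda>n::nat. {x\<in>{- real n<..<real n}. \<forall>q>0. steep_at g q x} \<union>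
    (\<Union>p\<in>\<rat>. \<Union>q\<in>\<rat>. if 0 < p \<and> p < q then {x\<in>{- real n<..<real n}. flat_at g p x \<and> steep_at g q x} else {}))"
  have "negligible (B n)" for n
    unfolding B_def
  proof (intro negligible_Un negligible_vertical[OF assms] negligible_countable_Union countable_image countable_rat; clarify)
    fix p :: real
    show "negligible (\<Union>q\<in>\<rat>. if 0 < p \<and> p < q then {x\<in>{- real n<..<real n}. flat_at g p x \<and> steep_at g q x} else {})"
      by (intro negligible_countable_Union countable_image countable_rat)
        (use negligible_oscillating[OF assms, of p] in \<open>auto simp del: greaterThanLessThan_iff\<close>)
  qed
  then have "negligible (\<Union>n. B n)" by (rule negligible_Union_nat)
  moreover have "{x. \<not> g differentiable at x} \<subseteq> (\<Union>n. B n)"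
  proof
    fix x assume "x \<in> {x. \<not> g differentiable at x}"
    moreover obtain n :: nat where "\<bar>x\<bar> < real n" using reals_Archimedean2 by blast
    ultimately have "x \<in> B n"
      using differentiable_or_oscillating[OF assms, of x] unfolding B_def by (force simp: abs_less_iff)
    then show "x \<in> (\<Union>n. B n)" by blast
  qed
  ultimately show ?thesis by (rule negligible_subset)
qed

section \<open>Absolutely continuous functions as differences of monotone functions\<close>

text \<open>
  The finite families of non-overlapping intervals that occur in \<^const>\<open>abs_cont_on\<close>. Degenerate
  intervals are allowed, which makes the families stable under truncation at a point.
\<close>

definition interval_family :: "real set \<Rightarrow> nat \<Rightarrow> (nat \<Rightarrow> real) \<Rightarrow> (nat \<Rightarrow> real) \<Rightarrow> bool" where
  "interval_family S n l r \<longleftrightarrow>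
     (\<forall>i<n. l i \<le> r i \<and> {l i..r i} \<subseteq> S) \<and> disjoint_family_on (\<lambda>i. {l i<..<r i}) {..<n}"

lemma abs_cont_onD:
  assumes "abs_cont_on S u" "\<epsilon> > 0"
  obtains \<delta> where "\<delta> > 0" "\<And>n l r. interval_family S n l r \<Longrightarrow> (\<Sum>i<n. r i - l i) < \<delta> \<Longrightarrow>
    (\<Sum>i<n. \<bar>u (r i) - u (l i)\<bar>) < \<epsilon>"
  using assms unfolding abs_cont_on_def interval_family_def by meson

lemma interval_family_length:
  assumes "interval_family {a..b} n l r" "a \<le> b"
  shows "(\<Sum>i<n. r i - l i) \<le> b - a"
proof -
  have lr: "l i \<le> r i" "{l i..r i} \<subseteq> {a..b}" if "i < n" for i
    using assms that unfolding interval_family_def by auto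
  have "ennreal (\<Sum>i<n. r i - l i) = (\<Sum>i<n. emeasure lborel {l i<..<r i})"
    by (subst sum_ennreal[symmetric]) (use lr in auto)
  also have "\<dots> = emeasure lborel (\<Union>i<n. {l i<..<r i})"
    by (rule sum_emeasure) (use assms in \<open>auto simp: interval_family_def\<close>)
  also have "\<dots> \<le> emeasure lborel {a..b}"
  proof (rule emeasure_mono)
    show "(\<Union>i<n. {l i<..<r i}) \<subseteq> {a..b}"
      using lr(2) greaterThanLessThan_subseteq_atLeastAtMost_iff by blast
  qed auto
  also have "\<dots> = ennreal (b - a)" using assms(2) by simp
  finally show ?thesis using assms(2) by (simp add: ennreal_le_iff)
qed

lemma disjoint_family_on_shrink:
  assumes "disjoint_family_on A I" "\<And>i. i \<in> I \<Longrightarrow> B i \<subseteq> A i"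
  shows "disjoint_family_on B I"
  unfolding disjoint_family_on_def
proof (intro ballI impI)
  fix i j assume ij: "i \<in> I" "j \<in> I" "i \<noteq> j"
  show "B i \<inter> B j = {}"
    using disjoint_family_onD[OF assms(1) ij] assms(2)[OF ij(1)] assms(2)[OF ij(2)] by blast
qed

text \<open>
  Cutting at \<open>z\<close> by \<open>min\<close> and \<open>max\<close> keeps the index set: an interval on one side of \<open>z\<close> becomes
  degenerate on the other side.
\<close>

lemma interval_family_split:
  assumes "interval_family {a..b} n l r" "a \<le> z" "z \<le> b"
  shows "interval_family {a..z} n (\<lambda>i. min (l i) z) (\<lambda>i. min (r i) z)"
    and "interval_family {z..b} n (\<lambda>i. max (l i) z) (\<lambda>i. max (r i) z)"
proof -
  have lr: "l i \<le> r i" "a \<le> l i" "r i \<le> b" if "i < n" for i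
    using assms that unfolding interval_family_def by auto
  have dj: "disjoint_family_on (\<lambda>i. {l i<..<r i}) {..<n}"
    using assms unfolding interval_family_def by auto
  have 1: "disjoint_family_on (\<lambda>i. {min (l i) z<..<min (r i) z}) {..<n}"
    by (rule disjoint_family_on_shrink[OF dj]) (use lr in \<open>auto simp: min_def max_def\<close>)
  have 2: "disjoint_family_on (\<lambda>i. {max (l i) z<..<max (r i) z}) {..<n}"
    by (rule disjoint_family_on_shrink[OF dj]) (use lr in \<open>auto simp: min_def max_def\<close>)
  show "interval_family {a..z} n (\<lambda>i. min (l i) z) (\<lambda>i. min (r i) z)"
    unfolding interval_family_def
  proof (intro conjI allI impI)
    fix i assume "i < n"
    then show "min (l i) z \<le> min (r i) z" "{min (l i) z..min (r i) z} \<subseteq> {a..z}"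
      using lr[of i] assms(2,3) by auto
  qed (rule 1)
  show "interval_family {z..b} n (\<lambda>i. max (l i) z) (\<lambda>i. max (r i) z)"
    unfolding interval_family_def
  proof (intro conjI allI impI)
    fix i assume "i < n"
    then show "max (l i) z \<le> max (r i) z" "{max (l i) z..max (r i) z} \<subseteq> {z..b}"
      using lr[of i] assms(2,3) by auto
  qed (rule 2)
qed

lemma interval_family_snoc:
  assumes "interval_family {a..x} n l r" "a \<le> x" "x \<le> y"
  shows "interval_family {a..y} (Suc n) (l(n := x)) (r(n := y))"
proof -
  have dj: "disjoint_family_on (\<lambda>i. {l i<..<r i}) {..<n}"
    using assms unfolding interval_family_def by auto
  have lr: "l i \<le> r i" "a \<le> l i" "r i \<le> x" if "i < n" for i
    using assms that unfolding interval_family_def by auto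
  have "{l i<..<r i} \<inter> {x<..<y} = {}" if "i < n" for i
    using lr[OF that] by auto
  then have "disjoint_family_on (\<lambda>i. {(l(n := x)) i<..<(r(n := y)) i}) {..<Suc n}"
    using dj unfolding disjoint_family_on_def by (fastforce simp: less_Suc_eq)
  moreover have "(l(n := x)) i \<le> (r(n := y)) i \<and> {(l(n := x)) i..(r(n := y)) i} \<subseteq> {a..y}" if "i < Suc n" for i
    using lr[of i] that assms(2,3) by (cases "i = n") (auto simp: less_Suc_eq)
  ultimately show ?thesis unfolding interval_family_def by blast
qed

definition increments :: "(real \<Rightarrow> real) \<Rightarrow> real \<Rightarrow> real \<Rightarrow> real set" where
  "increments u a x = {\<Sum>i<n. u (r i) - u (l i) | n l r. interval_family {a..x} n l r}"

text \<open>
  The positive variation. Its difference with \<open>u\<close> is again monotone, so that an absolutely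
  continuous function is a difference of two monotone functions.
\<close>

definition pos_var :: "(real \<Rightarrow> real) \<Rightarrow> real \<Rightarrow> real \<Rightarrow> real" where
  "pos_var u a x = Sup (increments u a x)"

lemma increments_0: "0 \<in> increments u a x"
  unfolding increments_def interval_family_def
  by (auto intro!: exI[of _ "0::nat"] simp: disjoint_family_on_def)

lemma increments_mono: "x \<le> y \<Longrightarrow> increments u a x \<subseteq> increments u a y"
  unfolding increments_def interval_family_def
  using order_trans[OF _ atLeastatMost_subset_iff[THEN iffD2], of _ a x a y] by blast

text \<open>
  Absolute continuity bounds the increments over any interval shorter than \<open>\<delta>\<close> by \<open>1\<close>. Cutting
  off pieces of length at most \<open>\<delta>/2\<close> from the right shows that \<open>k\<close> pieces contribute at most \<open>k\<close>.
\<close>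

lemma bdd_above_increments:
  assumes "abs_cont_on {a..b} u" "a \<le> b"
  shows "bdd_above (increments u a b)"
proof -
  obtain \<delta> where \<delta>: "\<delta> > 0" "\<And>n l r. interval_family {a..b} n l r \<Longrightarrow> (\<Sum>i<n. r i - l i) < \<delta> \<Longrightarrow>
      (\<Sum>i<n. \<bar>u (r i) - u (l i)\<bar>) < 1"
    by (rule abs_cont_onD[OF assms(1), of 1]) auto
  have *: "(\<Sum>i<n. u (r i) - u (l i)) \<le> real k"
    if "interval_family {a..x} n l r" "a \<le> x" "x \<le> b" "x - a \<le> real k * (\<delta> / 2)" for k x n l r
    using that
  proof (induction k arbitrary: x l r)
    case 0
    have "l i = r i" if "i < n" for i
    proof -
      have "l i \<le> r i" "{l i..r i} \<subseteq> {a..x}" using 0(1) that unfolding interval_family_def by auto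
      then show ?thesis using 0(4) by simp
    qed
    then show ?case by simp
  next
    case (Suc k)
    \<comment> \<open>The piece to the right of \<open>z\<close> is strictly shorter than \<open>\<delta>\<close>.\<close>
    define z where "z = max a (x - \<delta> / 2)"
    have z: "a \<le> z" "z \<le> x" "z - a \<le> real k * (\<delta> / 2)"
      using Suc.prems \<delta>(1) by (auto simp: z_def algebra_simps max_def)
    note sp = interval_family_split[OF Suc.prems(1) z(1,2)]
    have "(\<Sum>i<n. max (r i) z - max (l i) z) \<le> x - z"
      by (rule interval_family_length[OF sp(2) z(2)])
    also have "x - z < \<delta>" using \<delta>(1) by (auto simp: z_def)
    finally have len: "(\<Sum>i<n. max (r i) z - max (l i) z) < \<delta>" .
    have "interval_family {a..b} n (\<lambda>i. max (l i) z) (\<lambda>i. max (r i) z)"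
      using sp(2) order_trans[OF _ atLeastatMost_subset_iff[THEN iffD2], of _ z x a b] z Suc.prems(3)
      unfolding interval_family_def by blast
    from \<delta>(2)[OF this len] have "(\<Sum>i<n. u (max (r i) z) - u (max (l i) z)) \<le> 1"
      using sum_mono[of "{..<n}" "\<lambda>i. u (max (r i) z) - u (max (l i) z)" "\<lambda>i. \<bar>u (max (r i) z) - u (max (l i) z)\<bar>"]
      by fastforce
    moreover have "(\<Sum>i<n. u (min (r i) z) - u (min (l i) z)) \<le> real k"
      using Suc.IH[OF sp(1) z(1) _ z(3)] z(2) Suc.prems(3) by simp
    moreover have "(\<Sum>i<n. u (r i) - u (l i)) =
        (\<Sum>i<n. u (min (r i) z) - u (min (l i) z)) + (\<Sum>i<n. u (max (r i) z) - u (max (l i) z))"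
      unfolding sum.distrib[symmetric] by (rule sum.cong) (auto simp: min_def max_def)
    ultimately show ?case by simp
  qed
  obtain k :: nat where "(b - a) / (\<delta> / 2) \<le> real k" using real_arch_simple by blast
  then have "b - a \<le> real k * (\<delta> / 2)" using \<delta>(1) by (simp add: field_simps)
  then show ?thesis
    using *[of b] assms(2) by (intro bdd_aboveI[of _ "real k"]) (auto simp: increments_def)
qed

text \<open>
  The second claim comes from adding the interval from \<open>x\<close> to \<open>y\<close> to a family below \<open>x\<close>; it says
  that \<open>pos_var u a x - u x\<close> increases with \<open>x\<close>.
\<close>

lemma pos_var_mono:
  assumes "abs_cont_on {a..b} u" "a \<le> x" "x \<le> y" "y \<le> b"
  shows "pos_var u a x \<le> pos_var u a y"
    and "pos_var u a x + (u y - u x) \<le> pos_var u a y"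
proof -
  have bdd: "bdd_above (increments u a y)"
    using bdd_above_increments[OF assms(1)] increments_mono[of y b u a] assms
    by (meson bdd_above_mono order_trans)
  show 1: "pos_var u a x \<le> pos_var u a y"
    unfolding pos_var_def
    using increments_0[of u a x] by (intro cSup_subset_mono bdd increments_mono[OF assms(3)]) blast
  show 2: "pos_var u a x + (u y - u x) \<le> pos_var u a y"
  proof -
    have "pos_var u a x \<le> pos_var u a y - (u y - u x)"
      unfolding pos_var_def[of u a x]
    proof (rule cSup_least)
      show "increments u a x \<noteq> {}" using increments_0[of u a x] by blast
      fix s assume "s \<in> increments u a x"
      then obtain n l r where s: "s = (\<Sum>i<n. u (r i) - u (l i))" and f: "interval_family {a..x} n l r"
        unfolding increments_def by blast
      have "s + (u y - u x) = (\<Sum>i<Suc n. u ((r(n := y)) i) - u ((l(n := x)) i))"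
        unfolding s by simp
      then have "s + (u y - u x) \<in> increments u a y"
        using interval_family_snoc[OF f assms(2,3)] unfolding increments_def by blast
      then show "s \<le> pos_var u a y - (u y - u x)"
        using cSup_upper[OF _ bdd] unfolding pos_var_def by (metis le_diff_eq)
    qed
    then show ?thesis by simp
  qed
qed

lemma abs_cont_on_differentiable_ae:
  assumes "abs_cont_on {a..b} u" "a \<le> b"
  shows "negligible {x\<in>{a<..<b}. \<not> u differentiable at x}"
proof -
  define cl where "cl = (\<lambda>x. max a (min b x))"
  have cl: "a \<le> cl x" "cl x \<le> b" "x \<le> y \<Longrightarrow> cl x \<le> cl y" for x y
    using assms(2) by (auto simp: cl_def)
  define P where "P = (\<lambda>x. pos_var u a (cl x))"
  define N where "N = (\<lambda>x. P x - u (cl x))"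
  have "mono P" unfolding P_def using pos_var_mono(1)[OF assms(1)] cl by (intro monoI) blast
  moreover have "mono N"
  proof (rule monoI)
    fix x y :: real assume "x \<le> y"
    then show "N x \<le> N y" unfolding N_def P_def using pos_var_mono(2)[OF assms(1) cl(1) cl(3) cl(2)] by force
  qed
  ultimately have "negligible ({x. \<not> P differentiable at x} \<union> {x. \<not> N differentiable at x})"
    by (intro negligible_Un mono_differentiable_ae)
  moreover have "u differentiable at x" if PN: "P differentiable at x" "N differentiable at x" "x \<in> {a<..<b}" for x
  proof -
    obtain D where "((\<lambda>y. P y - N y) has_field_derivative D) (at x)"
      using differentiable_diff[OF PN(1,2)] real_differentiable_def by blast
    moreover have "\<forall>\<^sub>F y in nhds x. P y - N y = u y"
      using eventually_nhds_in_open[of "{a<..<b}" x] PN(3)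
      by (auto elim!: eventually_mono simp: N_def cl_def)
    ultimately have "(u has_field_derivative D) (at x)"
      using DERIV_cong_ev[of x x "\<lambda>y. P y - N y" u D D] by simp
    then show ?thesis using real_differentiable_def by blast
  qed
  ultimately show ?thesis by (rule_tac negligible_subset) blast+
qed

section \<open>Continuity and images of null sets\<close>

lemma abs_cont_on_reflect:
  assumes "abs_cont_on {-b..b} u"
  shows "abs_cont_on {-b..b} (\<lambda>x. u (- x))"
  unfolding abs_cont_on_def
proof (intro allI impI)
  fix \<epsilon> :: real assume "\<epsilon> > 0"
  obtain \<delta> where \<delta>: "\<delta> > 0" "\<And>n l r. interval_family {-b..b} n l r \<Longrightarrow> (\<Sum>i<n. r i - l i) < \<delta> \<Longrightarrow>
      (\<Sum>i<n. \<bar>u (r i) - u (l i)\<bar>) < \<epsilon>"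
    by (rule abs_cont_onD[OF assms \<open>\<epsilon> > 0\<close>]) auto
  show "\<exists>\<delta>>0. \<forall>(n::nat) l r. (\<forall>i<n. l i \<le> r i \<and> {l i..r i} \<subseteq> {-b..b}) \<and> disjoint_family_on (\<lambda>i. {l i<..<r i}) {..<n} \<and>
      (\<Sum>i<n. r i - l i) < \<delta> \<longrightarrow> (\<Sum>i<n. \<bar>u (- r i) - u (- l i)\<bar>) < \<epsilon>"
  proof (intro exI[of _ \<delta>] conjI \<delta>(1) allI impI)
    fix n :: nat and l r :: "nat \<Rightarrow> real"
    assume "(\<forall>i<n. l i \<le> r i \<and> {l i..r i} \<subseteq> {-b..b}) \<and> disjoint_family_on (\<lambda>i. {l i<..<r i}) {..<n} \<and>
      (\<Sum>i<n. r i - l i) < \<delta>"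
    then have lr: "\<forall>i<n. l i \<le> r i \<and> {l i..r i} \<subseteq> {-b..b}" and dj: "disjoint_family_on (\<lambda>i. {l i<..<r i}) {..<n}"
      and len: "(\<Sum>i<n. r i - l i) < \<delta>" by blast+
    have "{- r i<..<- l i} = uminus ` {l i<..<r i}" for i by simp
    then have "disjoint_family_on (\<lambda>i. {- r i<..<- l i}) {..<n}"
      using dj unfolding disjoint_family_on_def by (metis image_Int[OF inj_uminus] image_empty)
    then have "interval_family {-b..b} n (\<lambda>i. - r i) (\<lambda>i. - l i)"
      using lr unfolding interval_family_def by force
    from \<delta>(2)[OF this] len show "(\<Sum>i<n. \<bar>u (- r i) - u (- l i)\<bar>) < \<epsilon>"
      by (simp add: abs_minus_commute)
  qed
qed

lemma abs_cont_on_single: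
  assumes "abs_cont_on S u" "\<epsilon> > 0"
  obtains \<delta> where "\<delta> > 0" "\<And>x y. {x..y} \<subseteq> S \<Longrightarrow> x \<le> y \<Longrightarrow> y - x < \<delta> \<Longrightarrow> \<bar>u y - u x\<bar> < \<epsilon>"
proof -
  obtain \<delta> where \<delta>: "\<delta> > 0" "\<And>n l r. interval_family S n l r \<Longrightarrow> (\<Sum>i<n. r i - l i) < \<delta> \<Longrightarrow>
      (\<Sum>i<n. \<bar>u (r i) - u (l i)\<bar>) < \<epsilon>"
    by (rule abs_cont_onD[OF assms]) auto
  show thesis
  proof (rule that[OF \<delta>(1)])
    fix x y assume "{x..y} \<subseteq> S" "x \<le> y" "y - x < \<delta>"
    then show "\<bar>u y - u x\<bar> < \<epsilon>"
      using \<delta>(2)[of "Suc 0" "\<lambda>_. x" "\<lambda>_. y"]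
      by (auto simp: interval_family_def disjoint_family_on_def)
  qed
qed

lemma abs_cont_on_imp_continuous:
  assumes "abs_cont_on {a..b} u"
  shows "continuous_on {a..b} u"
  unfolding continuous_on_iff
proof (intro ballI allI impI)
  fix x \<epsilon> :: real assume x: "x \<in> {a..b}" and "\<epsilon> > 0"
  obtain \<delta> where \<delta>: "\<delta> > 0" "\<And>x y. {x..y} \<subseteq> {a..b} \<Longrightarrow> x \<le> y \<Longrightarrow> y - x < \<delta> \<Longrightarrow> \<bar>u y - u x\<bar> < \<epsilon>"
    by (rule abs_cont_on_single[OF assms \<open>\<epsilon> > 0\<close>]) auto
  have "dist (u y) (u x) < \<epsilon>" if y: "y \<in> {a..b}" "dist y x < \<delta>" for y
    using \<delta>(2)[of x y] \<delta>(2)[of y x] x y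
    by (cases "x \<le> y") (auto simp: dist_real_def abs_minus_commute)
  then show "\<exists>d>0. \<forall>x'\<in>{a..b}. dist x' x < d \<longrightarrow> dist (u x') (u x) < \<epsilon>"
    using \<delta>(1) by blast
qed

text \<open>
  The points \<open>p\<close> and \<open>q\<close> are a minimizer and a maximizer in increasing order. The length of the image is
  then the increment over one subinterval, which absolute continuity controls.
\<close>

lemma image_interval_between:
  fixes u :: "real \<Rightarrow> real"
  assumes "continuous_on {c..d} u" "c \<le> d"
  obtains p q where "p \<in> {c..d}" "q \<in> {c..d}" "p \<le> q" "u ` {c..d} \<subseteq> {min (u p) (u q)..max (u p) (u q)}"
proof -
  have "compact {c..d}" "{c..d} \<noteq> {}" using assms by auto
  then obtain p q where pq: "p \<in> {c..d}" "\<And>y. y \<in> {c..d} \<Longrightarrow> u p \<le> u y"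
      "q \<in> {c..d}" "\<And>y. y \<in> {c..d} \<Longrightarrow> u y \<le> u q"
    using continuous_attains_inf[OF _ _ assms(1)] continuous_attains_sup[OF _ _ assms(1)] by metis
  have "u ` {c..d} \<subseteq> {u p..u q}" using pq(2,4) by auto
  moreover have "u p \<le> u q" using pq(2)[OF pq(3)] .
  ultimately show thesis
    using that[of p q] that[of q p] pq(1,3) by (cases "p \<le> q") (simp_all add: min_absorb1 min_absorb2 max_absorb1 max_absorb2)
qed

text \<open>
  Luzin's property (N). The null set is covered by non-overlapping intervals inside an open set
  of measure less than \<open>\<delta>\<close>. In each of them an interval between extremal points of \<open>u\<close> represents
  the image, so finitely many images have total length less than \<open>\<epsilon>\<close>.
\<close>

lemma abs_cont_on_negligible_image:
  assumes ac: "abs_cont_on {a..b} u" and N: "negligible N" "N \<subseteq> {a..b}" and "a < b"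
  shows "negligible (u ` N)"
  unfolding negligible_outer_le
proof (intro allI impI)
  fix \<epsilon> :: real assume "\<epsilon> > 0"
  obtain \<delta> where \<delta>: "\<delta> > 0" "\<And>n l r. interval_family {a..b} n l r \<Longrightarrow> (\<Sum>i<n. r i - l i) < \<delta> \<Longrightarrow>
      (\<Sum>i<n. \<bar>u (r i) - u (l i)\<bar>) < \<epsilon>"
    by (rule abs_cont_onD[OF ac \<open>\<epsilon> > 0\<close>]) auto
  have "N \<in> sets lebesgue" using N(1) negligible_imp_sets by blast
  then obtain U where U: "open U" "N \<subseteq> U" "emeasure lebesgue (U - N) < ennreal \<delta>"
    by (rule sets_lebesgue_outer_open[OF _ \<delta>(1)])
  have eU: "emeasure lebesgue U < ennreal \<delta>"
  proof -
    have "N \<in> null_sets lebesgue" using N(1) negligible_iff_null_sets by blast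
    then have "emeasure lebesgue (U - N) = emeasure lebesgue U"
      using U(1) by (intro emeasure_Diff_null_set) auto
    then show ?thesis using U(3) by simp
  qed
  have "\<forall>x. \<exists>e>0. x \<in> U \<longrightarrow> ball x e \<subseteq> U"
    using U(1) unfolding open_contains_ball by (meson zero_less_one)
  then obtain e where e: "\<And>x. e x > 0" "\<And>x. x \<in> U \<Longrightarrow> ball x (e x) \<subseteq> U" by metis
  have gauge: "gauge (\<lambda>x. ball x (e x))" using e(1) by (simp add: gauge_ball_dependent)
  obtain \<D> where D: "countable \<D>" "\<Union>\<D> \<subseteq> cbox a b"
      "\<And>K. K \<in> \<D> \<Longrightarrow> interior K \<noteq> {} \<and> (\<exists>c d. K = cbox c d)"
      "pairwise (\<lambda>A B. interior A \<inter> interior B = {}) \<D>"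
      "\<And>K. K \<in> \<D> \<Longrightarrow> \<exists>x \<in> N \<inter> K. K \<subseteq> ball x (e x)" "N \<subseteq> \<Union>\<D>"
  proof (rule covering_lemma)
    show "N \<subseteq> cbox a b" "box a b \<noteq> {}" using N(2) \<open>a < b\<close> by auto
    show "gauge (\<lambda>x. ball x (e x))" by (rule gauge)
  qed blast
  have DU: "K \<subseteq> U" if "K \<in> \<D>" for K
    using D(5)[OF that] e(2) U(2) by blast
  have "\<exists>p q. p \<in> K \<and> q \<in> K \<and> p \<le> q \<and> {p<..<q} \<subseteq> interior K \<and> {p..q} \<subseteq> K \<and>
      u ` K \<subseteq> {min (u p) (u q)..max (u p) (u q)}" if K: "K \<in> \<D>" for K
  proof -
    obtain c d where cd: "K = {c..d}" "c \<le> d"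
    proof -
      obtain c d where cd: "K = cbox c d" using D(3)[OF K] by blast
      have "K \<noteq> {}" using D(3)[OF K] by auto
      then show thesis using cd that[of c d] by simp
    qed
    have "K \<subseteq> {a..b}" using D(2) K by auto
    then have "continuous_on {c..d} u"
      using abs_cont_on_imp_continuous[OF ac] continuous_on_subset cd by blast
    from image_interval_between[OF this cd(2)] obtain p q where
      "p \<in> {c..d}" "q \<in> {c..d}" "p \<le> q" "u ` {c..d} \<subseteq> {min (u p) (u q)..max (u p) (u q)}" by blast
    note pq = this
    have "{p<..<q} \<subseteq> interior K" using pq(1,2) unfolding cd(1) by auto
    moreover have "{p..q} \<subseteq> K" using pq(1,2) unfolding cd(1) by auto
    ultimately show ?thesis using pq unfolding cd(1) by blast
  qed
  then obtain p q where pq: "\<And>K. K \<in> \<D> \<Longrightarrow> p K \<in> K \<and> q K \<in> K \<and> p K \<le> q K \<and> {p K<..<q K} \<subseteq> interior K \<and>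
      {p K..q K} \<subseteq> K \<and> u ` K \<subseteq> {min (u (p K)) (u (q K))..max (u (p K)) (u (q K))}" by metis
  define R where "R = (\<lambda>K. {min (u (p K)) (u (q K))..max (u (p K)) (u (q K))})"
  have mR: "measure lebesgue (R K) = \<bar>u (q K) - u (p K)\<bar>" for K
    unfolding R_def by (auto simp: min_def max_def)
  have bound: "(\<Sum>K\<in>F. measure lebesgue (R K)) \<le> \<epsilon>" if F: "F \<subseteq> \<D>" "finite F" for F
  proof -
    obtain h where h: "bij_betw h {..<card F} F"
      using F(2) by (metis bij_betw_from_nat_into_finite)
    have hF: "h i \<in> \<D>" if "i < card F" for i using h F(1) that bij_betwE by blast
    have fam: "interval_family {a..b} (card F) (p \<circ> h) (q \<circ> h)"
      unfolding interval_family_def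
    proof (intro conjI allI impI)
      fix i assume i: "i < card F"
      show "(p \<circ> h) i \<le> (q \<circ> h) i" using pq[OF hF[OF i]] by simp
      have "{p (h i)..q (h i)} \<subseteq> h i" using pq[OF hF[OF i]] by blast
      also have "h i \<subseteq> {a..b}" using D(2) hF[OF i] by auto
      finally show "{(p \<circ> h) i..(q \<circ> h) i} \<subseteq> {a..b}" by simp
    next
      show "disjoint_family_on (\<lambda>i. {(p \<circ> h) i<..<(q \<circ> h) i}) {..<card F}"
        unfolding disjoint_family_on_def
      proof (intro ballI impI)
        fix i j assume ij: "i \<in> {..<card F}" "j \<in> {..<card F}" "i \<noteq> j"
        then have "h i \<noteq> h j" using h by (auto simp: bij_betw_def inj_on_def)
        then have "interior (h i) \<inter> interior (h j) = {}"
          using D(4) hF ij by (auto simp: pairwise_def)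
        moreover have sub: "{(p \<circ> h) k<..<(q \<circ> h) k} \<subseteq> interior (h k)" if "k < card F" for k
          using pq[OF hF[OF that]] unfolding comp_def by blast
        ultimately show "{(p \<circ> h) i<..<(q \<circ> h) i} \<inter> {(p \<circ> h) j<..<(q \<circ> h) j} = {}"
          using sub[of i] sub[of j] ij by (metis disjoint_iff lessThan_iff subsetD)
      qed
    qed
    have "ennreal (\<Sum>i<card F. (q \<circ> h) i - (p \<circ> h) i) = (\<Sum>i<card F. emeasure lborel {(p \<circ> h) i<..<(q \<circ> h) i})"
      by (subst sum_ennreal[symmetric]) (use fam in \<open>auto simp: interval_family_def\<close>)
    also have "\<dots> = emeasure lborel (\<Union>i<card F. {(p \<circ> h) i<..<(q \<circ> h) i})"
      by (rule sum_emeasure) (use fam in \<open>auto simp: interval_family_def\<close>)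
    also have "\<dots> \<le> emeasure lborel U"
    proof (rule emeasure_mono)
      show "(\<Union>i<card F. {(p \<circ> h) i<..<(q \<circ> h) i}) \<subseteq> U"
      proof (intro UN_least)
        fix i assume "i \<in> {..<card F}"
        then have i: "h i \<in> \<D>" using hF by simp
        have "{(p \<circ> h) i<..<(q \<circ> h) i} \<subseteq> interior (h i)"
          using pq[OF i] unfolding comp_def by blast
        also have "\<dots> \<subseteq> U" using interior_subset DU[OF i] by blast
        finally show "{(p \<circ> h) i<..<(q \<circ> h) i} \<subseteq> U" .
      qed
    qed (use U in auto)
    also have "\<dots> < ennreal \<delta>" using eU U(1) by simp
    finally have "(\<Sum>i<card F. (q \<circ> h) i - (p \<circ> h) i) < \<delta>"
      by (meson ennreal_leI leD leI)
    from \<delta>(2)[OF fam this] have "(\<Sum>i<card F. measure lebesgue (R (h i))) < \<epsilon>"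
      unfolding mR by simp
    then show ?thesis
      using sum.reindex_bij_betw[OF h, of "\<lambda>K. measure lebesgue (R K)"] by simp
  qed
  have "(\<Union>K\<in>\<D>. R K) \<in> lmeasurable \<and> measure lebesgue (\<Union>K\<in>\<D>. R K) \<le> \<epsilon>"
  proof -
    have 1: "R K \<in> lmeasurable" for K unfolding R_def by simp
    have 2: "measure lebesgue (\<Union>K\<in>F. R K) \<le> \<epsilon>" if F: "F \<subseteq> \<D>" "finite F" for F
      using order_trans[OF measure_UNION_le[of F R lebesgue] bound[OF F]] F(2) fmeasurableD[OF 1] by blast
    show ?thesis
      using fmeasurable_UN_bound[OF D(1) 1 2] measure_UN_bound[OF D(1) 1 2] by blast
  qed
  moreover have "u ` N \<subseteq> (\<Union>K\<in>\<D>. R K)"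
    using D(6) pq unfolding R_def by blast
  ultimately show "\<exists>T. u ` N \<subseteq> T \<and> T \<in> lmeasurable \<and> measure lebesgue T \<le> \<epsilon>" by blast
qed

section \<open>Change of variables along records\<close>

text \<open>
  Boundedness of \<open>f\<close> and of the image makes \<open>f\<close> absolutely integrable on the image, so that the
  change of variables for absolutely integrable functions transfers to non-negative integrals.
\<close>

lemma nn_integral_change_of_variables:
  fixes g :: "real \<Rightarrow> real"
  assumes S: "S \<in> sets lebesgue" and der: "\<And>x. x \<in> S \<Longrightarrow> (g has_field_derivative g' x) (at x)"
    and inj: "inj_on g S" and bnd: "g ` S \<subseteq> {c..d}"
    and f: "f \<in> borel_measurable borel" "\<And>t. 0 \<le> f t" "\<And>t. f t \<le> K"
  shows "(\<integral>\<^sup>+x\<in>S. ennreal (\<bar>g' x\<bar> * f (g x)) \<partial>lebesgue) = (\<integral>\<^sup>+t\<in>g ` S. ennreal (f t) \<partial>lebesgue)"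
proof -
  have gS: "g ` S \<in> sets lebesgue"
    by (rule differentiable_image_in_sets_lebesgue[OF S])
      (use der in \<open>auto simp: differentiable_on_def real_differentiable_def intro: has_field_derivative_at_within\<close>)
  have fin: "emeasure lebesgue (g ` S) < \<infinity>"
  proof -
    have "emeasure lebesgue (g ` S) \<le> emeasure lebesgue {c..d}"
      by (rule emeasure_mono[OF bnd]) simp
    also have "\<dots> < \<infinity>" using emeasure_lborel_cbox_finite[of c d] by simp
    finally show ?thesis .
  qed
  have fm: "f \<in> borel_measurable lebesgue" using f(1) by (intro measurable_completion) simp
  have i1: "f absolutely_integrable_on g ` S"
    unfolding set_integrable_def
    by (rule integrableI_bounded_set_indicator[where B = K]) (use gS fin f fm in auto)
  have der': "(g has_field_derivative g' x) (at x within S)" if "x \<in> S" for x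
    using der[OF that] has_field_derivative_at_within by blast
  have i2: "(\<lambda>x. \<bar>g' x\<bar> * f (g x)) absolutely_integrable_on S"
    and eq: "integral S (\<lambda>x. \<bar>g' x\<bar> * f (g x)) = integral (g ` S) f"
    using has_absolute_integral_change_of_variables_1'[OF S der' inj, of f "integral (g ` S) f"] i1 by auto
  have *: "(\<integral>\<^sup>+x\<in>A. ennreal (h x) \<partial>lebesgue) = ennreal (integral A h)"
    if h: "h absolutely_integrable_on A" "\<And>x. 0 \<le> h x" for A and h :: "real \<Rightarrow> real"
  proof -
    have "(\<integral>\<^sup>+x\<in>A. ennreal (h x) \<partial>lebesgue) = (\<integral>\<^sup>+x. ennreal (indicator A x *\<^sub>R h x) \<partial>lebesgue)"
      by (rule nn_integral_cong) (auto simp: indicator_def)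
    also have "\<dots> = ennreal (LINT x:A|lebesgue. h x)"
      unfolding set_lebesgue_integral_def
      by (rule nn_integral_eq_integral) (use h in \<open>auto simp: set_integrable_def indicator_def\<close>)
    also have "(LINT x:A|lebesgue. h x) = integral A h"
      by (rule set_lebesgue_integral_eq_integral(2)[OF h(1)])
    finally show ?thesis .
  qed
  show ?thesis using *[OF i1 f(2)] *[OF i2] eq f(2) by simp
qed

text \<open>
  A record is the point where a level is reached for the first time from the left. On
  records \<open>u\<close> is injective, and by the intermediate value theorem it takes there all values
  between its value at \<open>a\<close> and its maximum; so they select one preimage of each level.
\<close>

definition records :: "(real \<Rightarrow> real) \<Rightarrow> real \<Rightarrow> real \<Rightarrow> real set" where
  "records u a b = {x\<in>{a..b}. \<forall>y\<in>{a..<x}. u y < u x}"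

text \<open>
  The level set is compact, and its least element is a record: a value above \<open>t\<close> further to
  the left would force the value \<open>t\<close> there too.
\<close>

lemma record_exists:
  fixes u :: "real \<Rightarrow> real"
  assumes cont: "continuous_on {a..b} u" and z: "z \<in> {a..b}" and t: "u a \<le> t" "t \<le> u z"
  shows "\<exists>x\<in>records u a b. u x = t"
proof -
  have "\<exists>x\<in>{a..b}. u x = t"
  proof -
    have "continuous_on {a..z} u" using cont continuous_on_subset z by fastforce
    then have "\<exists>x\<ge>a. x \<le> z \<and> u x = t" using IVT'[of u a t z] t z by auto
    then show ?thesis using z by auto
  qed
  moreover have "compact {x\<in>{a..b}. u x = t}"
    unfolding compact_eq_bounded_closed
  proof
    show "bounded {x\<in>{a..b}. u x = t}" by (rule bounded_subset[of "{a..b}"]) auto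
    show "closed {x\<in>{a..b}. u x = t}" by (rule continuous_closed_preimage_constant[OF cont]) auto
  qed
  ultimately have "\<exists>x\<in>{x\<in>{a..b}. u x = t}. \<forall>y\<in>{x\<in>{a..b}. u x = t}. x \<le> y"
    by (intro compact_attains_inf) auto
  then obtain x where x: "x \<in> {a..b}" "u x = t" "\<And>y. y \<in> {a..b} \<Longrightarrow> u y = t \<Longrightarrow> x \<le> y"
    by blast
  have "u y < u x" if y: "y \<in> {a..<x}" for y
  proof (rule ccontr)
    assume "\<not> u y < u x"
    moreover have "continuous_on {a..y} u" using cont continuous_on_subset x(1) y by fastforce
    ultimately obtain w where "a \<le> w" "w \<le> y" "u w = t" using IVT'[of u a t y] t x y by auto
    then show False using x(3)[of w] x(1) y by auto
  qed
  then show ?thesis using x unfolding records_def by blast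
qed

text \<open>
  A point fails to be a record if and only if some point at distance at least \<open>1/(n+1)\<close> to its
  left has at least the same value. For fixed \<open>n\<close> such points form the projection of a compact set.
\<close>

lemma records_borel:
  fixes u :: "real \<Rightarrow> real"
  assumes cont: "continuous_on {a..b} u"
  shows "records u a b \<in> sets borel"
proof -
  define C where "C = (\<lambda>n::nat. {p \<in> {a..b} \<times> {a..b}. snd p \<le> fst p - 1 / real (Suc n) \<and> u (fst p) \<le> u (snd p)})"
  have "compact (C n)" for n
  proof -
    have c: "continuous_on ({a..b} \<times> {a..b}) (\<lambda>p. u (fst p))" "continuous_on ({a..b} \<times> {a..b}) (\<lambda>p. u (snd p))"
      by (intro continuous_on_compose2[OF cont] continuous_intros; auto)+
    have cl: "closed ({a..b} \<times> {a..b})" by (intro closed_Times) auto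
    have "closed {p \<in> {a..b} \<times> {a..b}. snd p \<le> fst p - 1 / real (Suc n)}"
      by (rule continuous_on_closed_Collect_le[OF _ _ cl]) (intro continuous_intros)+
    moreover have "closed {p \<in> {a..b} \<times> {a..b}. u (fst p) \<le> u (snd p)}"
      by (rule continuous_on_closed_Collect_le[OF c cl])
    ultimately have "closed ({p \<in> {a..b} \<times> {a..b}. snd p \<le> fst p - 1 / real (Suc n)} \<inter>
       {p \<in> {a..b} \<times> {a..b}. u (fst p) \<le> u (snd p)})" by (rule closed_Int)
    also have "\<dots> = C n" unfolding C_def by blast
    finally have "closed (C n)" .
    moreover have "compact ({a..b} \<times> {a..b})" by (intro compact_Times) auto
    moreover have "C n \<subseteq> {a..b} \<times> {a..b}" unfolding C_def by auto
    ultimately show ?thesis by (metis closed_Int_compact inf.absorb_iff1)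
  qed
  then have "compact (fst ` C n)" for n
    by (intro compact_continuous_image continuous_intros) auto
  then have "closed (fst ` C n)" for n using compact_imp_closed by blast
  then have "(\<Union>n. fst ` C n) \<in> sets borel" by (intro sets.countable_UN) auto
  moreover have "records u a b = {a..b} - (\<Union>n. fst ` C n)"
  proof (intro equalityI subsetI)
    fix x assume x: "x \<in> records u a b"
    have "x \<notin> fst ` C n" for n
    proof
      assume "x \<in> fst ` C n"
      then obtain y where y: "y \<in> {a..b}" "y \<le> x - 1 / real (Suc n)" "u x \<le> u y"
        unfolding C_def by auto
      have "0 < 1 / real (Suc n)" by simp
      with y(2) have "y < x" by linarith
      then have "u y < u x" using x y(1) unfolding records_def by simp
      then show False using y(3) by simp
    qed
    then show "x \<in> {a..b} - (\<Union>n. fst ` C n)" using x unfolding records_def by auto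
  next
    fix x assume x: "x \<in> {a..b} - (\<Union>n. fst ` C n)"
    have "u y < u x" if y: "y \<in> {a..<x}" for y
    proof (rule ccontr)
      assume *: "\<not> u y < u x"
      obtain n where n: "1 / real (Suc n) < x - y"
        using y by (metis atLeastLessThan_iff diff_gt_0_iff_gt nat_approx_posE)
      then have "(x, y) \<in> C n" using x y * unfolding C_def by auto
      then have "x \<in> fst ` C n" by force
      then show False using x by auto
    qed
    then show "x \<in> records u a b" using x unfolding records_def by auto
  qed
  ultimately show ?thesis by simp
qed

text \<open>
  Almost every level is hit by a record at which \<open>u\<close> is differentiable: the exceptional points
  form a null set, and so do their values by property (N). This is where absolute continuity of
  \<open>u\<close> enters the lower bound for its energy.
\<close>

lemma regular_records:
  assumes ac: "abs_cont_on {a..b} u" and "a < b" and z: "z \<in> {a..b}"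
  obtains S where "S \<in> sets lebesgue" "S \<subseteq> records u a b"
    "\<And>x. x \<in> S \<Longrightarrow> u differentiable at x" "AE t in lebesgue. t \<in> {u a..u z} \<longrightarrow> t \<in> u ` S"
proof -
  define D where "D = {x\<in>{a<..<b}. \<not> u differentiable at x} \<union> {a, b}"
  have D: "negligible D" unfolding D_def
    using abs_cont_on_differentiable_ae[OF ac] \<open>a < b\<close> by (intro negligible_Un) auto
  have cont: "continuous_on {a..b} u" by (rule abs_cont_on_imp_continuous[OF ac])
  define S where "S = records u a b - D"
  have S: "S \<in> sets lebesgue" unfolding S_def
    using records_borel[OF cont] negligible_imp_sets[OF D] by (intro sets.Diff) auto
  have der: "u differentiable at x" if "x \<in> S" for x
    using that unfolding S_def D_def records_def by auto
  have "negligible (u ` D)"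
    by (rule abs_cont_on_negligible_image[OF ac D]) (use \<open>a < b\<close> in \<open>auto simp: D_def\<close>)
  then have null: "u ` D \<in> null_sets lebesgue" using negligible_iff_null_sets by blast
  have "AE t in lebesgue. t \<in> {u a..u z} \<longrightarrow> t \<in> u ` S"
    using AE_not_in[OF null]
  proof (rule AE_mp, intro AE_I2 impI)
    fix t assume "t \<notin> u ` D" "t \<in> {u a..u z}"
    then show "t \<in> u ` S"
      using record_exists[OF cont z, of t] unfolding S_def by auto
  qed
  then show thesis using that[OF S _ der] by (auto simp: S_def)
qed

lemma nn_integral_covered_by_image:
  fixes u :: "real \<Rightarrow> real"
  assumes S: "S \<in> sets lebesgue" "\<And>x. x \<in> S \<Longrightarrow> u differentiable at x" "inj_on u S" "bounded (u ` S)"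
    and cover: "AE t in lebesgue. t \<in> A \<longrightarrow> t \<in> u ` S"
    and f: "f \<in> borel_measurable borel" "\<And>t. 0 \<le> f t" "\<And>t. f t \<le> K"
  shows "(\<integral>\<^sup>+t\<in>A. ennreal (f t) \<partial>lebesgue) \<le> (\<integral>\<^sup>+x\<in>S. ennreal (\<bar>deriv u x\<bar> * f (u x)) \<partial>lebesgue)"
proof -
  have der: "(u has_field_derivative deriv u x) (at x)" if "x \<in> S" for x
    using S(2)[OF that] by (metis DERIV_deriv_iff_real_differentiable)
  obtain c d where bnd: "u ` S \<subseteq> {c..d}"
    using bounded_subset_cbox_symmetric[OF S(4)] by (metis cbox_interval)
  have "(\<integral>\<^sup>+t\<in>A. ennreal (f t) \<partial>lebesgue) \<le> (\<integral>\<^sup>+t\<in>u ` S. ennreal (f t) \<partial>lebesgue)"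
    by (rule nn_integral_mono_AE, rule AE_mp[OF cover]) (auto simp: indicator_def)
  also have "\<dots> = (\<integral>\<^sup>+x\<in>S. ennreal (\<bar>deriv u x\<bar> * f (u x)) \<partial>lebesgue)"
    by (rule nn_integral_change_of_variables[symmetric, OF S(1) der S(3) bnd f])
  finally show ?thesis .
qed

section \<open>The level sets of the symmetric rearrangement\<close>

text \<open>
  The parameter \<open>z\<close> is a maximum point, so that \<open>u z\<close> is the largest level.
\<close>

locale profile =
  fixes u :: "real \<Rightarrow> real" and z :: real
  assumes cont: "continuous_on {-1..1} u"
    and nonneg: "\<And>x. x \<in> {-1..1} \<Longrightarrow> 0 \<le> u x"
    and bdry: "u (-1) = 0" "u 1 = 0"
    and peak: "z \<in> {-1..1}" "\<And>x. x \<in> {-1..1} \<Longrightarrow> u x \<le> u z"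
begin

text \<open>
  The distribution function of \<open>u\<close>.
\<close>

definition m :: "real \<Rightarrow> real" where
  "m t = measure lebesgue (superlevel u t)"

lemma superlevel_borel: "superlevel u t \<in> sets borel"
proof -
  have "closed {x \<in> {-1..1}. u x \<le> t}"
    by (rule continuous_on_closed_Collect_le[OF cont]) auto
  moreover have "superlevel u t = {-1..1} - {x \<in> {-1..1}. u x \<le> t}"
    unfolding superlevel_def by auto
  ultimately show ?thesis by auto
qed

lemma superlevel_lmeasurable: "superlevel u t \<in> lmeasurable"
  by (rule fmeasurableI2[of "{-1..1}"]) (use superlevel_borel in \<open>auto simp: superlevel_def\<close>)

lemma m_antimono: "s \<le> t \<Longrightarrow> m t \<le> m s"
  unfolding m_def by (rule measure_mono_fmeasurable)
    (use superlevel_lmeasurable fmeasurableD in \<open>auto simp: superlevel_def\<close>)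

lemma m_bounds: "0 \<le> m t" "m t \<le> 2"
proof -
  have "m t \<le> measure lebesgue {-1..1::real}"
    unfolding m_def by (rule measure_mono_fmeasurable)
      (use superlevel_lmeasurable fmeasurableD in \<open>auto simp: superlevel_def\<close>)
  then show "m t \<le> 2" by simp
qed (simp add: m_def)

lemma m_above_peak: "u z \<le> t \<Longrightarrow> m t = 0"
proof -
  assume "u z \<le> t"
  then have "superlevel u t = {}" using peak(2) unfolding superlevel_def by force
  then show ?thesis unfolding m_def by simp
qed

lemma m_borel [measurable]: "m \<in> borel_measurable borel"
proof -
  have "(\<lambda>t. - m t) \<in> borel_measurable borel"
    by (rule borel_measurable_mono) (auto intro!: monoI m_antimono)
  then have "(\<lambda>t. - (- m t)) \<in> borel_measurable borel" by (rule borel_measurable_uminus)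
  then show ?thesis by simp
qed

text \<open>
  The superlevel set at \<open>t\<close> is the increasing union of the superlevel sets at levels \<open>t + 1/(n+1)\<close>.
\<close>

lemma m_right_continuous:
  assumes "c < m t"
  shows "\<exists>s>t. c < m s"
proof -
  define A where "A = (\<lambda>n::nat. superlevel u (t + 1 / real (Suc n)))"
  have "incseq A"
  proof (rule monoI)
    fix i j :: nat assume "i \<le> j"
    then have "1 / real (Suc j) \<le> 1 / real (Suc i)" by (simp add: field_simps)
    then show "A i \<subseteq> A j" unfolding A_def superlevel_def by auto
  qed
  moreover have "(\<Union>i. A i) = superlevel u t"
  proof (intro equalityI subsetI)
    fix x assume "x \<in> (\<Union>i. A i)"
    then obtain n where n: "x \<in> {-1..1}" "t + 1 / real (Suc n) < u x" unfolding A_def superlevel_def by blast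
    have "0 < 1 / real (Suc n)" by simp
    then have "t < u x" using n(2) by linarith
    with n(1) have "x \<in> {-1..1}" "t < u x" by blast+
    then show "x \<in> superlevel u t" unfolding superlevel_def by blast
  next
    fix x assume "x \<in> superlevel u t"
    then have x: "x \<in> {-1..1}" "0 < u x - t" unfolding superlevel_def by auto
    obtain n where "1 / real (Suc n) < u x - t" by (rule nat_approx_posE[OF x(2)])
    then have "x \<in> A n" using x unfolding A_def superlevel_def by auto
    then show "x \<in> (\<Union>i. A i)" by blast
  qed
  moreover have "range A \<subseteq> sets lebesgue"
    unfolding A_def using fmeasurableD[OF superlevel_lmeasurable] by blast
  ultimately have "(\<lambda>n. measure lebesgue (A n)) \<longlonglongrightarrow> measure lebesgue (superlevel u t)"
    using Lim_measure_incseq[of A lebesgue] fmeasurableD2[OF superlevel_lmeasurable[of t]] by simp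
  then have "\<forall>\<^sub>F n in sequentially. c < measure lebesgue (A n)"
    using assms order_tendstoD(1) unfolding m_def by blast
  then obtain n where "c < m (t + 1 / real (Suc n))"
    unfolding A_def m_def eventually_sequentially by blast
  moreover have "t < t + 1 / real (Suc n)" by simp
  ultimately show ?thesis by blast
qed

text \<open>
  The points with values strictly between \<open>t\<close> and \<open>s\<close> contain a non-empty open set, because the
  boundary values keep \<open>x\<close> away from the end points.
\<close>

lemma band_positive:
  assumes "x \<in> {-1..1}" "0 \<le> t" "t < u x" "u x < s"
  shows "m s < m t"
proof -
  have "x \<noteq> -1" "x \<noteq> 1" using assms bdry by auto
  then have x: "x \<in> {-1<..<1}" using assms(1) by auto
  have o: "open ({-1<..<1} \<inter> u -` {t<..<s})"
    by (rule continuous_open_preimage[OF continuous_on_subset[OF cont]]) auto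
  let ?B = "{-1<..<1} \<inter> u -` {t<..<s}"
  have B: "?B \<in> lmeasurable" by (rule fmeasurableI2[of "{-1..1}"]) (use o in auto)
  have "measure lebesgue ?B \<noteq> 0"
  proof
    assume "measure lebesgue ?B = 0"
    then have "negligible ?B" using B negligible_iff_measure by blast
    then have "?B = {}" using o open_not_negligible by blast
    then show False using x assms by auto
  qed
  then have "0 < measure lebesgue ?B" by (simp add: less_le)
  moreover have "measure lebesgue (superlevel u s \<union> ?B) = measure lebesgue (superlevel u s) + measure lebesgue ?B"
  proof -
    have "superlevel u s \<inter> ?B = {}" unfolding superlevel_def by auto
    then show ?thesis using measure_Un3[OF superlevel_lmeasurable B, of s] by simp
  qed
  moreover have "measure lebesgue (superlevel u s \<union> ?B) \<le> measure lebesgue (superlevel u t)"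
  proof (rule measure_mono_fmeasurable)
    show "superlevel u s \<union> ?B \<subseteq> superlevel u t" using assms(3,4) unfolding superlevel_def by auto
    show "superlevel u s \<union> ?B \<in> sets lebesgue"
      using fmeasurableD[OF superlevel_lmeasurable[of s]] fmeasurableD[OF B] by (rule sets.Un)
  qed (rule superlevel_lmeasurable)
  ultimately show ?thesis unfolding m_def by linarith
qed

text \<open>
  By continuity \<open>u\<close> does not jump over the levels between \<open>t\<close> and \<open>s\<close>. The rearrangement is defined
  by closed intervals; strictness is what yields the strict inequality in \<open>v_greater_iff\<close>.
\<close>

lemma m_strict:
  assumes "0 \<le> t" "t < s" "0 < m s"
  shows "m s < m t"
proof -
  have "superlevel u s \<noteq> {}" using assms(3) unfolding m_def by auto
  then obtain x where x: "x \<in> {-1..1}" "s < u x" unfolding superlevel_def by auto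
  have "continuous_on {-1..x} u" using cont continuous_on_subset x(1) by fastforce
  then obtain w where "-1 \<le> w" "w \<le> x" "u w = (t + s) / 2"
    using IVT'[of u "-1" "(t + s) / 2" x] bdry x assms by auto
  then show ?thesis using band_positive[of w t s] x assms by auto
qed

lemma superlevel_empty_iff:
  assumes "0 \<le> t"
  shows "superlevel u t = {} \<longleftrightarrow> m t = 0"
proof
  assume "m t = 0"
  show "superlevel u t = {}"
  proof (rule ccontr)
    assume "superlevel u t \<noteq> {}"
    then obtain x where "x \<in> {-1..1}" "t < u x" unfolding superlevel_def by auto
    then have "m (u x + 1) < m t" using band_positive[of x t "u x + 1"] assms by auto
    then show False using \<open>m t = 0\<close> m_bounds(1)[of "u x + 1"] by simp
  qed
qed (simp add: m_def)

abbreviation v :: "real \<Rightarrow> real" where "v \<equiv> sym_rearr u"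

text \<open>
  The levels whose rearranged superlevel set contains \<open>x\<close>. The condition \<open>0 < m t\<close> accounts for the empty
  superlevel sets, whose rearrangement is empty rather than \<open>{0}\<close>.
\<close>

definition layers :: "real \<Rightarrow> real set" where
  "layers x = {t. 0 \<le> t \<and> 0 < m t \<and> 2 * \<bar>x\<bar> \<le> m t}"

lemma layers_borel: "layers x \<in> sets borel"
  unfolding layers_def by measurable

lemma layers_bounded: "layers x \<subseteq> {0..u z}"
proof
  fix t assume "t \<in> layers x"
  then have "0 \<le> t" "0 < m t" unfolding layers_def by auto
  then show "t \<in> {0..u z}" using m_above_peak[of t] by force
qed

lemma layers_lmeasurable: "layers x \<in> lmeasurable"
  by (rule fmeasurableI2[of "{0..u z}"]) (use layers_borel layers_bounded in auto)

lemma v_eq: "v x = measure lebesgue (layers x)"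
proof -
  have *: "indicator {0..} t *\<^sub>R indicator (sym_set (superlevel u t)) x = (indicator (layers x) t :: real)" for t
  proof (cases "0 \<le> t")
    case True
    have "x \<in> sym_set (superlevel u t) \<longleftrightarrow> 0 < m t \<and> 2 * \<bar>x\<bar> \<le> m t"
      using superlevel_empty_iff[OF True] m_bounds(1)[of t]
      unfolding sym_set_def m_def[symmetric] by auto
    then show ?thesis using True unfolding layers_def indicator_def by auto
  qed (auto simp: layers_def indicator_def)
  show ?thesis
    unfolding sym_rearr_def set_lebesgue_integral_def * by simp
qed

lemma v_nonneg: "0 \<le> v x" unfolding v_eq by simp

text \<open>
  Some level \<open>s > t\<close> has \<open>x\<close> in its closed interval of length \<open>m s\<close> if and only if \<open>x\<close> is in the open
  interval of length \<open>m t\<close>, by strict monotonicity and right continuity of \<open>m\<close>. Everything else about \<open>v\<close> (it is even, decreasing away from \<open>0\<close>, equimeasurable with \<open>u\<close>) is read off from this.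
\<close>

lemma v_greater_iff:
  assumes "0 \<le> t"
  shows "t < v x \<longleftrightarrow> 2 * \<bar>x\<bar> < m t"
proof
  assume "2 * \<bar>x\<bar> < m t"
  then obtain s where s: "t < s" "2 * \<bar>x\<bar> < m s" using m_right_continuous by blast
  have "{0..s} \<subseteq> layers x"
  proof
    fix r assume "r \<in> {0..s}"
    then have "0 \<le> r" "m s \<le> m r" using m_antimono by auto
    then show "r \<in> layers x" using s(2) unfolding layers_def by auto
  qed
  then have "measure lebesgue {0..s} \<le> v x"
    unfolding v_eq by (rule measure_mono_fmeasurable) (auto intro: layers_lmeasurable)
  then show "t < v x" using s(1) assms by simp
next
  assume *: "t < v x"
  have "\<exists>s\<in>layers x. t < s"
  proof (rule ccontr)
    assume "\<not> (\<exists>s\<in>layers x. t < s)"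
    then have "layers x \<subseteq> {0..t}" unfolding layers_def by force
    then have "v x \<le> measure lebesgue {0..t}"
      unfolding v_eq by (rule measure_mono_fmeasurable) (use layers_borel in auto)
    then show False using * assms by simp
  qed
  then obtain s where s: "t < s" "0 < m s" "2 * \<bar>x\<bar> \<le> m s" unfolding layers_def by blast
  then show "2 * \<bar>x\<bar> < m t" using m_strict[OF assms s(1,2)] by simp
qed

lemma v_antimono_abs:
  assumes "\<bar>x\<bar> \<le> \<bar>y\<bar>"
  shows "v y \<le> v x"
proof (rule ccontr)
  assume "\<not> v y \<le> v x"
  then have "2 * \<bar>y\<bar> < m (v x)" using v_greater_iff[OF v_nonneg, of x y] by simp
  then have "v x < v x" using v_greater_iff[OF v_nonneg, of x x] assms by simp
  then show False by simp
qed

lemma v_minus [simp]: "v (- x) = v x"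
  using v_antimono_abs[of x "-x"] v_antimono_abs[of "-x" x] by simp

lemma v_le_peak: "v x \<le> u z"
proof (rule ccontr)
  assume "\<not> v x \<le> u z"
  moreover have "0 \<le> u z" using nonneg peak(1) by blast
  ultimately have "2 * \<bar>x\<bar> < m (u z)" using v_greater_iff[of "u z" x] by simp
  then show False using m_above_peak[of "u z"] by simp
qed

lemma v_superlevel: "{x. t < v x} = (if t < 0 then UNIV else {- (m t / 2)<..<m t / 2})"
  using v_greater_iff[of t] v_nonneg by (auto intro: less_le_trans simp: abs_less_iff)

lemma v_borel [measurable]: "v \<in> borel_measurable borel"
  unfolding borel_measurable_iff_greater using v_superlevel by simp

lemma u_borel: "u \<in> borel_measurable (restrict_space borel {-1..1})"
  using borel_measurable_continuous_on_restrict[OF cont] .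

lemma equimeasurable:
  assumes [measurable]: "H \<in> borel_measurable borel"
  shows "(\<integral>\<^sup>+x\<in>{-1..1}. H (u x) \<partial>lebesgue) = (\<integral>\<^sup>+x\<in>{-1..1}. H (v x) \<partial>lebesgue)"
proof -
  let ?R = "restrict_space lborel {-1..1::real}"
  have mu [measurable]: "u \<in> borel_measurable ?R"
    using u_borel by (simp add: measurable_cong_sets[OF sets_restrict_space_cong[OF sets_lborel] refl])
  have mv [measurable]: "v \<in> borel_measurable ?R"
    by (rule measurable_restrict_space1) simp
  have "distr ?R borel u = distr ?R borel v"
  proof (rule measure_eqI_generator_eq[where \<Omega> = UNIV and E = "range (\<lambda>a::real. {a<..})" and A = "\<lambda>n. {- real n<..}"])
    show "Int_stable (range (\<lambda>a::real. {a<..}))"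
      unfolding Int_stable_def by (auto intro: image_eqI[where x = "max _ _"])
    show "sets (distr ?R borel u) = sigma_sets UNIV (range (\<lambda>a::real. {a<..}))"
      "sets (distr ?R borel v) = sigma_sets UNIV (range (\<lambda>a::real. {a<..}))"
      by (simp_all add: borel_Ioi)
    show "(\<Union>n. {- real n<..}) = UNIV"
      by (auto, metis minus_less_iff reals_Archimedean2)
    fix X assume "X \<in> range (\<lambda>a::real. {a<..})"
    then obtain t where X: "X = {t<..}" by auto
    have "emeasure (distr ?R borel u) X = emeasure lborel (superlevel u t)"
      unfolding X by (subst emeasure_distr) (auto simp: space_restrict_space superlevel_def
        intro!: arg_cong[of _ _ "emeasure lborel"] emeasure_restrict_space[THEN trans])
    also have "\<dots> = emeasure lborel ({-1..1} \<inter> {x. t < v x})"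
    proof (cases "t < 0")
      case True
      then have "superlevel u t = {-1..1} \<inter> {x. t < v x}"
        unfolding superlevel_def v_superlevel using nonneg by force
      then show ?thesis by simp
    next
      case False
      have "{-1..1} \<inter> {x. t < v x} = {- (m t / 2)<..<m t / 2}"
        using False m_bounds(2)[of t] unfolding v_superlevel by auto
      then have "emeasure lborel ({-1..1} \<inter> {x. t < v x}) = ennreal (m t)"
        using m_bounds(1)[of t] by simp
      also have "\<dots> = emeasure lborel (superlevel u t)"
        using emeasure_eq_measure2[OF superlevel_lmeasurable] superlevel_borel unfolding m_def by simp
      finally show ?thesis by simp
    qed
    also have "\<dots> = emeasure (distr ?R borel v) X"
      unfolding X by (subst emeasure_distr) (auto simp: space_restrict_space
        intro!: arg_cong[of _ _ "emeasure lborel"] emeasure_restrict_space[THEN trans, symmetric])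
    finally show "emeasure (distr ?R borel u) X = emeasure (distr ?R borel v) X" .
  next
    fix n :: nat
    have "emeasure (distr ?R borel u) {- real n<..} \<le> emeasure ?R (space ?R)"
      by (subst emeasure_distr[OF mu]) (rule emeasure_space | simp)+
    also have "\<dots> < \<infinity>" by (simp add: space_restrict_space emeasure_restrict_space)
    finally show "emeasure (distr ?R borel u) {- real n<..} \<noteq> \<infinity>" by simp
  qed auto
  then have "(\<integral>\<^sup>+t. H t \<partial>distr ?R borel u) = (\<integral>\<^sup>+t. H t \<partial>distr ?R borel v)" by simp
  then have "(\<integral>\<^sup>+x. H (u x) \<partial>?R) = (\<integral>\<^sup>+x. H (v x) \<partial>?R)"
    by (simp add: nn_integral_distr)
  then show ?thesis
    by (simp add: nn_integral_restrict_space nn_integral_completion)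
qed

end

section \<open>The derivative of the rearrangement as a function of the level\<close>

text \<open>
  A Borel function that agrees with the derivative wherever the latter exists. It stands in for
  \<^const>\<open>deriv\<close>, whose values are arbitrary where the derivative does not exist.
\<close>

definition quotient_limit :: "(real \<Rightarrow> real) \<Rightarrow> real \<Rightarrow> real" where
  "quotient_limit g x = lim (\<lambda>n. (g (x + 1 / real (Suc n)) - g x) * real (Suc n))"

lemma quotient_limit_borel:
  assumes [measurable]: "g \<in> borel_measurable borel"
  shows "quotient_limit g \<in> borel_measurable borel"
  unfolding quotient_limit_def by measurable

lemma quotient_limit_eq:
  assumes "(g has_field_derivative D) (at x)"
  shows "quotient_limit g x = D"
proof -
  have "((\<lambda>y. (g y - g x) / (y - x)) \<longlongrightarrow> D) (at x)"
    using assms by (simp add: has_field_derivative_iff)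
  moreover have "filterlim (\<lambda>n. x + 1 / real (Suc n)) (at x) sequentially"
  proof (rule filterlim_atI)
    have "(\<lambda>n. x + 1 / real (Suc n)) \<longlonglongrightarrow> x + 0"
      by (intro tendsto_intros LIMSEQ_Suc[OF lim_1_over_n])
    then show "(\<lambda>n. x + 1 / real (Suc n)) \<longlonglongrightarrow> x" by simp
  qed auto
  ultimately have "(\<lambda>n. (g (x + 1 / real (Suc n)) - g x) / (x + 1 / real (Suc n) - x)) \<longlonglongrightarrow> D"
    by (rule filterlim_compose)
  then have "(\<lambda>n. (g (x + 1 / real (Suc n)) - g x) * real (Suc n)) \<longlonglongrightarrow> D"
    by simp
  then show ?thesis unfolding quotient_limit_def by (rule limI)
qed

context profile
begin

text \<open>
  To the right of \<open>0\<close> the rearrangement is monotone; made constant to the left of \<open>0\<close>, its negative is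
  increasing on the whole line.
\<close>

lemma v_differentiable_ae: "negligible {x. 0 < x \<and> \<not> v differentiable at x}"
proof -
  define g where "g = (\<lambda>x. - v (max 0 x))"
  have "mono g" unfolding g_def by (intro monoI) (auto intro!: v_antimono_abs)
  then have N: "negligible {x. \<not> g differentiable at x}" by (rule mono_differentiable_ae)
  have "v differentiable at x" if x: "0 < x" "g differentiable at x" for x
  proof -
    obtain D where "(g has_field_derivative D) (at x)"
      using x(2) real_differentiable_def by blast
    then have "((\<lambda>y. - g y) has_field_derivative - D) (at x)" by (rule DERIV_minus)
    moreover have "\<forall>\<^sub>F y in nhds x. - g y = v y"
      using eventually_nhds_in_open[of "{0<..}" x] x(1)
      by (auto elim!: eventually_mono simp: g_def max_def)
    ultimately have "(v has_field_derivative - D) (at x)"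
      using DERIV_cong_ev[of x x "\<lambda>y. - g y" v "- D" "- D"] by simp
    then show ?thesis using real_differentiable_def by blast
  qed
  then show ?thesis by (intro negligible_subset[OF N]) blast
qed

definition descent :: "real \<Rightarrow> real" where
  "descent x = - quotient_limit v x"

lemma descent_borel [measurable]: "descent \<in> borel_measurable borel"
  unfolding descent_def using quotient_limit_borel[OF v_borel] by measurable

text \<open>
  A Borel null set. It must be Borel, not only Lebesgue measurable, because \<open>slope\<close> below is a composition
  with \<open>m\<close>.
\<close>

definition singular :: "real set" where
  "singular = (SOME N. N \<in> null_sets lborel \<and> {x. 0 < x \<and> \<not> v differentiable at x} \<subseteq> N)"

lemma singular: "singular \<in> null_sets lborel" "0 < x \<Longrightarrow> x \<notin> singular \<Longrightarrow> v differentiable at x"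
proof -
  have "\<exists>N. N \<in> null_sets lborel \<and> {x. 0 < x \<and> \<not> v differentiable at x} \<subseteq> N"
    using v_differentiable_ae unfolding negligible_iff_null_sets null_sets_completion_iff2 by blast
  from someI_ex[OF this]
  show "singular \<in> null_sets lborel" "0 < x \<Longrightarrow> x \<notin> singular \<Longrightarrow> v differentiable at x"
    unfolding singular_def[symmetric] by blast+
qed

lemma v_deriv:
  assumes "0 < x" "x \<notin> singular"
  shows "(v has_field_derivative - descent x) (at x)" "0 \<le> descent x"
proof -
  obtain D where D: "(v has_field_derivative D) (at x)"
    using singular(2)[OF assms] real_differentiable_def by blast
  then show 1: "(v has_field_derivative - descent x) (at x)"
    using quotient_limit_eq[OF D] by (simp add: descent_def)
  show "0 \<le> descent x"
  proof (rule ccontr)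
    assume "\<not> 0 \<le> descent x"
    then obtain d where d: "d > 0" "\<And>h. h > 0 \<Longrightarrow> h < d \<Longrightarrow> v x < v (x + h)"
      using DERIV_pos_inc_right[OF 1] by auto
    have "v (x + d / 2) \<le> v x" using assms(1) d(1) by (intro v_antimono_abs) auto
    then show False using d(2)[of "d / 2"] d(1) by simp
  qed
qed

definition descent_set :: "real set" where
  "descent_set = {x \<in> {0<..<1} - singular. 0 < descent x}"

lemma descent_set_borel [measurable]: "descent_set \<in> sets borel"
proof -
  have [measurable]: "singular \<in> sets borel" using null_setsD2[OF singular(1)] by simp
  show ?thesis unfolding descent_set_def by measurable
qed

text \<open>
  At a point \<open>x\<close> of strict descent the level \<open>t = v x\<close> determines \<open>x\<close>: values left of \<open>x\<close> exceed \<open>t\<close>,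
  so \<open>2 x \<le> m t\<close>, while \<open>x\<close> itself is not in the superlevel set.
\<close>

lemma level_of_descent:
  assumes "x \<in> descent_set"
  shows "m (v x) / 2 = x"
proof -
  have x: "0 < x" "x \<notin> singular" "0 < descent x" using assms unfolding descent_set_def by auto
  obtain d where d: "d > 0" "\<And>h. h > 0 \<Longrightarrow> h < d \<Longrightarrow> v x < v (x - h)"
    using DERIV_neg_dec_left[OF v_deriv(1)[OF x(1,2)]] x(3) by auto
  have "2 * x \<le> m (v x)"
  proof (rule ccontr)
    assume *: "\<not> 2 * x \<le> m (v x)"
    \<comment> \<open>Small enough that \<open>x - h\<close> stays non-negative and outside the interval of length \<open>m (v x)\<close>.\<close>
    define h where "h = min (min (d / 2) x) ((2 * x - m (v x)) / 2)"
    have h: "0 < h" "h < d" "h \<le> x" "2 * h \<le> 2 * x - m (v x)"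
      using d(1) x(1) * by (auto simp: h_def min_def field_simps)
    have "2 * \<bar>x - h\<bar> < m (v x)"
      using d(2)[OF h(1,2)] v_greater_iff[OF v_nonneg, of x "x - h"] by simp
    then show False using h by simp
  qed
  moreover have "\<not> 2 * x < m (v x)"
    using v_greater_iff[OF v_nonneg, of x x] x(1) by simp
  ultimately show ?thesis by simp
qed

text \<open>
  The derivative \<open>|v'|\<close> as a Borel function of the level. It is set to \<open>0\<close> on levels that are not
  attained at a point of strict descent; by \<open>slope_at\<close> this agrees with \<open>|v'|\<close> at almost every
  point, also on plateaus.
\<close>

definition slope :: "real \<Rightarrow> real" where
  "slope t = (if m t / 2 \<in> descent_set \<and> v (m t / 2) = t then descent (m t / 2) else 0)"

lemma slope_borel [measurable]: "slope \<in> borel_measurable borel"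
  unfolding slope_def by measurable

lemma slope_nonneg: "0 \<le> slope t"
  using v_deriv(2) unfolding slope_def descent_set_def by auto

text \<open>
  If the descent at \<open>x\<close> vanishes but the level of \<open>x\<close> is also attained at a point \<open>w\<close> of strict descent, then
  \<open>v\<close> is constant between \<open>x\<close> and \<open>w\<close>, which contradicts the negative derivative at \<open>w\<close>.
\<close>

lemma slope_at:
  assumes "x \<in> {0<..<1}" "x \<notin> singular"
  shows "slope (v x) = descent x" "slope (v x) \<noteq> 0 \<Longrightarrow> m (v x) / 2 = x"
proof -
  have "slope (v x) = descent x \<and> (slope (v x) \<noteq> 0 \<longrightarrow> m (v x) / 2 = x)"
  proof (cases "x \<in> descent_set")
    case True
    then show ?thesis using level_of_descent[OF True] unfolding slope_def by simp
  next
    case False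
    then have d0: "descent x = 0" using assms v_deriv(2)[of x] unfolding descent_set_def by force
    have "slope (v x) = 0"
    proof (rule ccontr)
      assume "slope (v x) \<noteq> 0"
      define w where "w = m (v x) / 2"
      have w: "w \<in> descent_set" "v w = v x"
        using \<open>slope (v x) \<noteq> 0\<close> unfolding slope_def w_def by (auto split: if_splits)
      then have wp: "0 < w" "w \<notin> singular" "- descent w < 0" unfolding descent_set_def by auto
      have "w \<noteq> x" using w(1) False by auto
      then consider "w < x" | "x < w" by linarith
      then show False
      proof cases
        case 1
        obtain d where d: "d > 0" "\<And>h. h > 0 \<Longrightarrow> h < d \<Longrightarrow> v (w + h) < v w"
          using DERIV_neg_dec_right[OF v_deriv(1)[OF wp(1,2)] wp(3)] by auto
        define h where "h = min (d / 2) (x - w)"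
        have h: "0 < h" "h < d" "w + h \<le> x" using d(1) 1 by (auto simp: h_def)
        have "v x \<le> v (w + h)" by (rule v_antimono_abs) (use h wp in auto)
        then show False using d(2)[OF h(1,2)] w(2) by simp
      next
        case 2
        obtain d where d: "d > 0" "\<And>h. h > 0 \<Longrightarrow> h < d \<Longrightarrow> v w < v (w - h)"
          using DERIV_neg_dec_left[OF v_deriv(1)[OF wp(1,2)] wp(3)] by auto
        define h where "h = min (d / 2) (w - x)"
        have h: "0 < h" "h < d" "x \<le> w - h" using d(1) 2 by (auto simp: h_def)
        have "v (w - h) \<le> v x" by (rule v_antimono_abs) (use h assms in auto)
        then show False using d(2)[OF h(1,2)] w(2) by simp
      qed
    qed
    then show ?thesis using d0 by simp
  qed
  then show "slope (v x) = descent x" "slope (v x) \<noteq> 0 \<Longrightarrow> m (v x) / 2 = x" by auto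
qed

lemma slope_ae:
  "AE x in lebesgue. x \<in> {-1..1} \<longrightarrow>
     \<bar>deriv v x\<bar> = slope (v x) \<and> (slope (v x) \<noteq> 0 \<longrightarrow> m (v x) / 2 = \<bar>x\<bar>)"
proof -
  have n1: "singular \<in> null_sets lebesgue" using singular(1) by (rule null_sets_completionI)
  then have "negligible singular" using negligible_iff_null_sets by blast
  then have "negligible (uminus ` singular)"
    by (intro negligible_differentiable_image_negligible) (auto intro!: derivative_intros simp: differentiable_on_def)
  then have n2: "uminus ` singular \<in> null_sets lebesgue" using negligible_iff_null_sets by blast
  have n3: "{-1, 0, 1::real} \<in> null_sets lebesgue" by (intro null_sets_completionI finite_imp_null_set_lborel) auto
  have "AE x in lebesgue. x \<notin> singular \<and> x \<notin> uminus ` singular \<and> x \<notin> {-1, 0, 1}"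
    using AE_not_in[OF n1] AE_not_in[OF n2] AE_not_in[OF n3] by eventually_elim blast
  then show ?thesis
  proof eventually_elim
    case (elim x)
    show ?case
    proof
      assume x: "x \<in> {-1..1}"
      have ns: "\<bar>x\<bar> \<notin> singular" "\<bar>x\<bar> \<in> {0<..<1}"
        using elim x by (auto simp: abs_if image_iff dest: spec[of _ "-x"]) 
      have "\<bar>deriv v x\<bar> = descent \<bar>x\<bar>"
      proof (cases "0 < x")
        case True
        then have "deriv v x = - descent x" using v_deriv(1)[of x] ns by (intro DERIV_imp_deriv) auto
        then show ?thesis using v_deriv(2)[of x] ns True by simp
      next
        case False
        have "(v has_field_derivative - descent (-x)) (at (-x))"
          using v_deriv(1)[of "-x"] ns False elim by auto
        then have "((\<lambda>y. v (- y)) has_field_derivative - descent (-x) * (-1)) (at x)"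
          by (intro DERIV_chain2[of v]) (auto intro!: derivative_eq_intros)
        then have "deriv v x = descent (-x)" by (intro DERIV_imp_deriv) simp
        then show ?thesis using v_deriv(2)[of "-x"] ns False elim by auto
      qed
      moreover have "v \<bar>x\<bar> = v x" by (cases "0 \<le> x") auto
      ultimately show "\<bar>deriv v x\<bar> = slope (v x) \<and> (slope (v x) \<noteq> 0 \<longrightarrow> m (v x) / 2 = \<bar>x\<bar>)"
        using slope_at[OF ns(2,1)] by simp
    qed
  qed
qed

text \<open>
  Change of variables on the points of strict descent, where \<open>v\<close> is injective with inverse
  \<open>t \<mapsto> m t / 2\<close>.
\<close>

lemma slope_integral_descent:
  assumes f: "f \<in> borel_measurable borel" "\<And>t. 0 \<le> f t" "\<And>t. f t \<le> K"
  shows "(\<integral>\<^sup>+x\<in>descent_set. ennreal (descent x * f (v x)) \<partial>lebesgue) \<le> (\<integral>\<^sup>+t\<in>{0..u z}. ennreal (f t) \<partial>lebesgue)"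
proof -
  have "(\<integral>\<^sup>+x\<in>descent_set. ennreal (descent x * f (v x)) \<partial>lebesgue) = (\<integral>\<^sup>+x\<in>descent_set. ennreal (\<bar>- descent x\<bar> * f (v x)) \<partial>lebesgue)"
    by (rule nn_integral_cong) (auto simp: indicator_def descent_set_def v_deriv(2))
  also have "\<dots> = (\<integral>\<^sup>+t\<in>v ` descent_set. ennreal (f t) \<partial>lebesgue)"
  proof (rule nn_integral_change_of_variables[where c = 0 and d = "u z", OF _ _ _ _ f])
    show "inj_on v descent_set" by (rule inj_on_inverseI[of _ "\<lambda>t. m t / 2"]) (rule level_of_descent)
    show "v ` descent_set \<subseteq> {0..u z}" using v_nonneg v_le_peak by auto
  qed (use v_deriv(1) in \<open>auto simp: descent_set_def\<close>, use descent_set_borel in \<open>auto simp: descent_set_def\<close>)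
  also have "\<dots> \<le> (\<integral>\<^sup>+t\<in>{0..u z}. ennreal (f t) \<partial>lebesgue)"
    by (rule nn_integral_mono) (use v_nonneg v_le_peak in \<open>auto simp: indicator_def\<close>)
  finally show ?thesis .
qed

text \<open>
  The left-hand side depends on \<open>u\<close> only through its values, so \<open>u\<close> may be replaced by \<open>v\<close>. The factor
  \<open>2\<close> counts the two halves of the even function \<open>v\<close>.
\<close>

lemma slope_integral:
  assumes f: "f \<in> borel_measurable borel" "\<And>t. 0 \<le> f t" "\<And>t. f t \<le> K"
  shows "(\<integral>\<^sup>+x\<in>{-1..1}. ennreal (slope (u x) * f (u x)) \<partial>lebesgue) \<le>
    2 * (\<integral>\<^sup>+t\<in>{0..u z}. ennreal (f t) \<partial>lebesgue)"
proof -
  note [measurable] = f(1)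
  define h where "h = (\<lambda>x. ennreal (slope (v x) * f (v x)))"
  have h [measurable]: "h \<in> borel_measurable borel" unfolding h_def by measurable
  have n3: "{-1, 0, 1::real} \<in> null_sets lborel" by (intro finite_imp_null_set_lborel) auto
  have "(\<integral>\<^sup>+x\<in>{-1..1}. ennreal (slope (u x) * f (u x)) \<partial>lebesgue) = (\<integral>\<^sup>+x\<in>{-1..1}. h x \<partial>lebesgue)"
    unfolding h_def using equimeasurable[of "\<lambda>t. ennreal (slope t * f t)"] by simp
  also have "\<dots> = (\<integral>\<^sup>+x. h x * indicator {-1..1} x \<partial>lborel)" by (simp add: nn_integral_completion)
  also have "\<dots> = (\<integral>\<^sup>+x. h x * indicator {0<..<1} x + h x * indicator {-1<..<0} x \<partial>lborel)"
    by (rule nn_integral_cong_AE, rule AE_mp[OF AE_not_in[OF n3]]) (auto simp: indicator_def)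
  also have "\<dots> = (\<integral>\<^sup>+x. h x * indicator {0<..<1} x \<partial>lborel) + (\<integral>\<^sup>+x. h x * indicator {-1<..<0} x \<partial>lborel)"
    by (rule nn_integral_add) auto
  also have "(\<integral>\<^sup>+x. h x * indicator {-1<..<0} x \<partial>lborel) = (\<integral>\<^sup>+x. h x * indicator {0<..<1} x \<partial>lborel)"
    by (subst nn_integral_real_affine[where c = "-1" and t = 0])
      (auto intro!: nn_integral_cong simp: h_def indicator_def)
  also have "(\<integral>\<^sup>+x. h x * indicator {0<..<1} x \<partial>lborel) = (\<integral>\<^sup>+x. ennreal (descent x * f (v x)) * indicator descent_set x \<partial>lborel)"
  proof (rule nn_integral_cong_AE, rule AE_mp[OF AE_not_in[OF singular(1)]], intro AE_I2 impI)
    fix x assume "x \<notin> singular"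
    then show "h x * indicator {0<..<1} x = ennreal (descent x * f (v x)) * indicator descent_set x"
      using slope_at(1)[of x] v_deriv(2)[of x] unfolding h_def descent_set_def
      by (cases "x \<in> {0<..<1}") (auto simp: indicator_def not_less)
  qed
  also have "(\<integral>\<^sup>+x. ennreal (descent x * f (v x)) * indicator descent_set x \<partial>lborel) =
      (\<integral>\<^sup>+x\<in>descent_set. ennreal (descent x * f (v x)) \<partial>lebesgue)" by (simp add: nn_integral_completion)
  also have "\<dots> + \<dots> = 2 * \<dots>" by (simp add: mult_2)
  also have "\<dots> \<le> 2 * (\<integral>\<^sup>+t\<in>{0..u z}. ennreal (f t) \<partial>lebesgue)"
    by (intro mult_left_mono slope_integral_descent[OF f]) auto
  finally show ?thesis .
qed

end

section \<open>Subgradients of convex functions\<close>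

text \<open>
  The left derivative of a convex function, written as the limit of a sequence so that its
  dependence on parameters is visibly Borel.
\<close>

definition left_slope :: "(real \<Rightarrow> real) \<Rightarrow> real \<Rightarrow> real" where
  "left_slope \<phi> P = lim (\<lambda>n. (\<phi> P - \<phi> (P - P / real (Suc n))) / (P / real (Suc n)))"

text \<open>
  The quotients increase to the left derivative, which lies below all slopes to the right of \<open>P\<close>
  and above all slopes to the left of \<open>P\<close>.
\<close>

lemma left_slope_subgradient:
  fixes \<phi> :: "real \<Rightarrow> real"
  assumes conv: "convex_on {0..} \<phi>" and mono: "mono_on {0..} \<phi>" and P: "0 < P"
  shows "0 \<le> left_slope \<phi> P" and "0 \<le> p \<Longrightarrow> \<phi> P + left_slope \<phi> P * (p - P) \<le> \<phi> p"
proof -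
  define h where "h = (\<lambda>n. P / real (Suc n))"
  define s where "s = (\<lambda>n. (\<phi> P - \<phi> (P - h n)) / h n)"
  have h: "0 < h n" "h n \<le> P" for n
    using P by (auto simp: h_def divide_le_eq intro: mult_left_mono[of 1 "1 + real n" P, simplified])
  have hlim: "h \<longlonglongrightarrow> 0"
    unfolding h_def using tendsto_mult_right_zero[OF LIMSEQ_Suc[OF lim_1_over_n], of P] by simp
  have s_eq: "s n = (\<phi> (P - h n) - \<phi> P) / ((P - h n) - P)" for n
    using h(1)[of n] unfolding s_def by (simp add: field_simps)
  have "incseq s"
  proof (rule monoI)
    fix i j :: nat assume "i \<le> j"
    then have "h j \<le> h i" using P unfolding h_def by (intro divide_left_mono) auto
    then consider "h j = h i" | "h j < h i" by linarith
    then show "s i \<le> s j"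
    proof cases
      case 2
      then show ?thesis unfolding s_eq
        using convex_on_slope_le(2)[OF conv, of "P - h i" P "P - h j"] h P by auto
    qed (simp add: s_def)
  qed
  have upper: "s n \<le> (\<phi> P - \<phi> p) / (P - p)" if "P < p" for n p
    unfolding s_eq
    using convex_on_slope_le[OF conv, of "P - h n" p P] h[of n] that P by auto
  obtain L where L: "s \<longlonglongrightarrow> L" "\<And>n. s n \<le> L"
    using incseq_convergent[OF \<open>incseq s\<close>, of "(\<phi> P - \<phi> (P + 1)) / (P - (P + 1))"] upper[of "P + 1"] by auto
  have eq: "left_slope \<phi> P = L"
    unfolding left_slope_def by (rule limI) (use L(1) in \<open>simp add: s_def h_def\<close>)
  have "\<phi> (P - h 0) \<le> \<phi> P" using mono_onD[OF mono, of "P - h 0" P] h[of 0] P by simp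
  then have "0 \<le> s 0" unfolding s_def using h(1)[of 0] by (intro divide_nonneg_pos) auto
  then show "0 \<le> left_slope \<phi> P" using L(2)[of 0] unfolding eq by linarith
  show "\<phi> P + left_slope \<phi> P * (p - P) \<le> \<phi> p" if "0 \<le> p"
  proof (cases p P rule: linorder_cases)
    case greater
    have "L \<le> (\<phi> P - \<phi> p) / (P - p)"
      by (rule LIMSEQ_le_const2[OF L(1)]) (use upper[OF greater] in auto)
    then show ?thesis using greater unfolding eq by (simp add: field_simps)
  next
    case less
    have "\<forall>\<^sub>F n in sequentially. h n < P - p"
      using order_tendstoD(2)[OF hlim, of "P - p"] less by simp
    then obtain n where n: "h n < P - p" unfolding eventually_sequentially by blast
    have "(\<phi> p - \<phi> P) / (p - P) \<le> s n"
      unfolding s_eq using convex_on_slope_le(2)[OF conv, of p P "P - h n"] n h[of n] that P by auto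
    also have "\<dots> \<le> L" by (rule L(2))
    finally show ?thesis using less unfolding eq by (simp add: field_simps)
  qed simp
qed

section \<open>The outermost points of a level\<close>

context profile
begin

text \<open>
  The outermost points at which \<open>u\<close> reaches the level \<open>t\<close>. The added end points only serve to
  make the functions total and monotone on the whole line, hence Borel.
\<close>

definition first_hit :: "real \<Rightarrow> real" where
  "first_hit t = Inf ({x \<in> {-1..1}. t \<le> u x} \<union> {1})"

definition last_hit :: "real \<Rightarrow> real" where
  "last_hit t = Sup ({x \<in> {-1..1}. t \<le> u x} \<union> {-1})"

lemma bdd_hits: "bdd_below ({x \<in> {-1..1}. t \<le> u x} \<union> {1})" "bdd_above ({x \<in> {-1..1}. t \<le> u x} \<union> {-1})"
  by (rule bdd_belowI[of _ "-1"] bdd_aboveI[of _ 1]; auto)+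

lemma first_hit_borel [measurable]: "first_hit \<in> borel_measurable borel"
  by (rule borel_measurable_mono, rule monoI, unfold first_hit_def, rule cInf_superset_mono)
    (use bdd_hits in auto)

lemma last_hit_borel [measurable]: "last_hit \<in> borel_measurable borel"
proof -
  have "mono (\<lambda>t. - last_hit t)"
  proof (rule monoI)
    fix s t :: real assume "s \<le> t"
    then have "last_hit t \<le> last_hit s"
      unfolding last_hit_def by (intro cSup_subset_mono) (use bdd_hits in auto)
    then show "- last_hit s \<le> - last_hit t" by simp
  qed
  then have "(\<lambda>t. - (- last_hit t)) \<in> borel_measurable borel"
    by (intro borel_measurable_uminus borel_measurable_mono)
  then show ?thesis by simp
qed

lemma hit_bounds:
  assumes "x \<in> {-1..1}" "t \<le> u x"
  shows "first_hit t \<le> x" "x \<le> last_hit t"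
  unfolding first_hit_def last_hit_def
  by (rule cInf_lower cSup_upper; use assms bdd_hits in auto)+

lemma hit_range: "first_hit t \<in> {-1..1}" "last_hit t \<in> {-1..1}"
proof -
  have "-1 \<le> first_hit t" "last_hit t \<le> 1"
    unfolding first_hit_def last_hit_def by (rule cInf_greatest cSup_least; auto)+
  moreover have "first_hit t \<le> 1" "-1 \<le> last_hit t"
    unfolding first_hit_def last_hit_def by (rule cInf_lower cSup_upper; use bdd_hits in auto)+
  ultimately show "first_hit t \<in> {-1..1}" "last_hit t \<in> {-1..1}" by auto
qed

lemma first_hit_record:
  assumes "x \<in> records u (-1) 1"
  shows "first_hit (u x) = x"
proof (rule antisym)
  have x: "x \<in> {-1..1}" "\<And>y. y \<in> {-1..<x} \<Longrightarrow> u y < u x" using assms unfolding records_def by auto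
  show "first_hit (u x) \<le> x" using hit_bounds(1)[OF x(1)] by simp
  show "x \<le> first_hit (u x)"
    unfolding first_hit_def
  proof (rule cInf_greatest)
    fix w assume "w \<in> {w \<in> {-1..1}. u x \<le> u w} \<union> {1}"
    then show "x \<le> w" using x(1) x(2)[of w] by force
  qed auto
qed

lemma last_hit_record:
  assumes "- x \<in> records (\<lambda>x. u (- x)) (-1) 1"
  shows "last_hit (u x) = x"
proof (rule antisym)
  have x: "x \<in> {-1..1}" "\<And>y. y \<in> {-1..<-x} \<Longrightarrow> u (- y) < u x" using assms unfolding records_def by auto
  show "x \<le> last_hit (u x)" using hit_bounds(2)[OF x(1)] by simp
  show "last_hit (u x) \<le> x"
    unfolding last_hit_def
  proof (rule cSup_least)
    fix w assume "w \<in> {w \<in> {-1..1}. u x \<le> u w} \<union> {-1}"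
    then show "w \<le> x" using x(1) x(2)[of "- w"] by force
  qed auto
qed

text \<open>
  The superlevel set lies between the outermost points of its level.
\<close>

lemma m_le_hit_distance:
  assumes "t \<le> u z"
  shows "m t \<le> last_hit t - first_hit t"
proof -
  have le: "first_hit t \<le> last_hit t" using hit_bounds[OF peak(1) assms] by linarith
  have "m t \<le> measure lebesgue {first_hit t..last_hit t}"
    unfolding m_def
  proof (rule measure_mono_fmeasurable)
    show "superlevel u t \<subseteq> {first_hit t..last_hit t}"
      using hit_bounds[of _ t] unfolding superlevel_def by force
  qed (use superlevel_lmeasurable fmeasurableD in auto)
  then show ?thesis using le by simp
qed

end

section \<open>Comparison of weighted variations\<close>

text \<open>
  A point \<open>x\<close> between \<open>0\<close> and \<open>y\<close> is a convex combination of \<open>y\<close> and \<open>- y\<close>, where \<open>b\<close> takes the same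
  value.
\<close>

lemma even_convex_mono:
  fixes b :: "real \<Rightarrow> real"
  assumes conv: "convex_on {-1..1} b" and even: "\<And>x. x \<in> {-1..1} \<Longrightarrow> b (- x) = b x"
    and xy: "0 \<le> x" "x \<le> y" "y \<le> 1"
  shows "b x \<le> b y"
proof (cases "y = 0")
  case False
  then have y: "0 < y" using xy by simp
  define \<mu> where "\<mu> = (1 + x / y) / 2"
  have \<mu>: "0 \<le> \<mu>" "\<mu> \<le> 1" "x = (1 - \<mu>) * (- y) + \<mu> * y"
    using xy y by (auto simp: \<mu>_def field_simps)
  have "b ((1 - \<mu>) *\<^sub>R (- y) + \<mu> *\<^sub>R y) \<le> (1 - \<mu>) * b (- y) + \<mu> * b y"
    by (rule convex_onD[OF conv \<mu>(1,2)]) (use xy in auto)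
  also have "\<dots> = b y" using even[of y] xy by (simp add: algebra_simps)
  finally show ?thesis using \<mu>(3) by simp
qed (use xy in auto)

text \<open>
  The point \<open>(r - l) / 2\<close> is the midpoint of \<open>r\<close> and \<open>- l\<close>, and an even convex function increases with
  the distance from \<open>0\<close>.
\<close>

lemma even_convex_midpoint:
  fixes b :: "real \<Rightarrow> real"
  assumes conv: "convex_on {-1..1} b" and even: "\<And>x. x \<in> {-1..1} \<Longrightarrow> b (- x) = b x"
    and lr: "l \<in> {-1..1}" "r \<in> {-1..1}" and y: "0 \<le> y" "2 * y \<le> r - l"
  shows "2 * b y \<le> b l + b r"
proof -
  have "b y \<le> b ((r - l) / 2)"
    by (rule even_convex_mono[OF conv even]) (use lr y in auto)
  also have "(r - l) / 2 = (1 - 1 / 2) *\<^sub>R r + (1 / 2) *\<^sub>R (- l)" by (simp add: field_simps)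
  also have "b \<dots> \<le> (1 - 1 / 2) * b r + (1 / 2) * b (- l)"
    by (rule convex_onD[OF conv]) (use lr in auto)
  also have "\<dots> = (b l + b r) / 2" using even[OF lr(1)] by simp
  finally show ?thesis by simp
qed

text \<open>
  The weight is taken continuous and bounded on the whole plane; for the energies at hand this is
  achieved by composing it with projections onto the relevant rectangle.
\<close>

locale weighted_profile = profile +
  fixes a :: "real \<Rightarrow> real \<Rightarrow> real" and B :: real
  assumes ac: "abs_cont_on {-1..1} u"
    and a_cont: "continuous_on UNIV (\<lambda>p. a (fst p) (snd p))"
    and a_bounds: "0 \<le> a x t" "a x t \<le> B"
    and a_even: "x \<in> {-1..1} \<Longrightarrow> a (- x) t = a x t"
    and a_convex: "convex_on {-1..1} (\<lambda>x. a x t)"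
begin

lemma a_borel [measurable (raw)]:
  "f \<in> borel_measurable M \<Longrightarrow> g \<in> borel_measurable M \<Longrightarrow> (\<lambda>x. a (f x) (g x)) \<in> borel_measurable M"
  using borel_measurable_continuous_Pair[OF _ _ a_cont] .

text \<open>
  Here convexity and evenness of the weight enter. The rearrangement attains the level \<open>t\<close> at the
  points \<open>\<plusminus> m t / 2\<close>, whose distance is at most that of the outermost points where \<open>u\<close> attains it.
\<close>

lemma weight_at_hits:
  assumes "t \<le> u z"
  shows "2 * a (m t / 2) t \<le> a (first_hit t) t + a (last_hit t) t"
  by (rule even_convex_midpoint[OF a_convex])
    (use a_even hit_range m_bounds m_le_hit_distance[OF assms] in auto)

lemma regular_first_hits:
  obtains S1 where "S1 \<in> sets lebesgue" "S1 \<subseteq> records u (-1) 1" "\<And>x. x \<in> S1 \<Longrightarrow> u differentiable at x"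
    "AE t in lebesgue. t \<in> {0..u z} \<longrightarrow> t \<in> u ` S1"
  by (rule regular_records[OF ac _ peak(1)]) (use bdry(1) in auto)

text \<open>
  The last hits are the records of the reflected function.
\<close>

lemma regular_last_hits:
  obtains S2 where "S2 \<in> sets lebesgue" "S2 \<subseteq> uminus ` records (\<lambda>x. u (- x)) (-1) 1"
    "\<And>x. x \<in> S2 \<Longrightarrow> u differentiable at x" "AE t in lebesgue. t \<in> {0..u z} \<longrightarrow> t \<in> u ` S2"
proof -
  have ac': "abs_cont_on {-1..1} (\<lambda>x. u (- x))" using abs_cont_on_reflect[of 1 u] ac by simp
  obtain T where T: "T \<in> sets lebesgue" "T \<subseteq> records (\<lambda>x. u (- x)) (-1) 1"
      "\<And>x. x \<in> T \<Longrightarrow> (\<lambda>x. u (- x)) differentiable at x"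
      "AE t in lebesgue. t \<in> {0..u z} \<longrightarrow> t \<in> (\<lambda>x. u (- x)) ` T"
    by (rule regular_records[OF ac', of "- z"]) (use peak(1) bdry(2) in auto)
  show thesis
  proof (rule that[of "uminus ` T"])
    show "uminus ` T \<in> sets lebesgue"
      by (rule differentiable_image_in_sets_lebesgue[OF T(1)])
        (auto intro!: derivative_intros simp: differentiable_on_def)
    fix x assume "x \<in> uminus ` T"
    then have "(\<lambda>x. u (- x)) differentiable at (- x)" using T(3) by auto
    then obtain D where "((\<lambda>x. u (- x)) has_field_derivative D) (at (- x))"
      using real_differentiable_def by blast
    then have "((\<lambda>y. u (- (- y))) has_field_derivative D * (-1)) (at x)"
      by (intro DERIV_chain2[of "\<lambda>x. u (- x)"]) (auto intro!: derivative_eq_intros)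
    then show "u differentiable at x" using real_differentiable_def by auto
  qed (use T(2,4) in \<open>auto simp: image_image\<close>)
qed

definition u_ext :: "real \<Rightarrow> real" where
  "u_ext x = u (max (-1) (min 1 x))"

lemma u_ext_borel [measurable]: "u_ext \<in> borel_measurable borel"
  unfolding u_ext_def
  by (intro borel_measurable_continuous_onI continuous_on_compose2[OF cont] continuous_intros) auto

lemma u_ext_eq: "x \<in> {-1..1} \<Longrightarrow> u_ext x = u x"
  unfolding u_ext_def by (auto simp: max_def min_def)

definition du :: "real \<Rightarrow> real" where
  "du = quotient_limit u_ext"

lemma du_borel [measurable]: "du \<in> borel_measurable borel"
  unfolding du_def by (rule quotient_limit_borel[OF u_ext_borel])

lemma deriv_ae: "AE x in lebesgue. x \<in> {-1..1} \<longrightarrow> deriv u x = du x"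
proof -
  have "negligible ({x\<in>{-1<..<1}. \<not> u differentiable at x} \<union> {-1, 1})"
    using abs_cont_on_differentiable_ae[OF ac] by (intro negligible_Un) auto
  then have "{x\<in>{-1<..<1}. \<not> u differentiable at x} \<union> {-1, 1} \<in> null_sets lebesgue"
    using negligible_iff_null_sets by blast
  from AE_not_in[OF this] show ?thesis
  proof (rule AE_mp, intro AE_I2 impI)
    fix x assume "x \<notin> {x\<in>{-1<..<1}. \<not> u differentiable at x} \<union> {-1, 1}" "x \<in> {-1..1}"
    then have x: "x \<in> {-1<..<1}" "u differentiable at x" by auto
    obtain D where D: "(u has_field_derivative D) (at x)"
      using x(2) real_differentiable_def by blast
    have ev: "\<forall>\<^sub>F y in nhds x. u y = u_ext y"
      using eventually_nhds_in_open[of "{-1<..<1}" x] x(1)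
      by (auto elim!: eventually_mono simp: u_ext_eq)
    have "(u_ext has_field_derivative D) (at x)"
      using DERIV_cong_ev[of x x u u_ext D D] ev D by simp
    then show "deriv u x = du x"
      unfolding du_def using quotient_limit_eq DERIV_imp_deriv[OF D] by simp
  qed
qed

text \<open>
  The regular first and last hits form two sets with at most one common point, a strict
  maximum point of \<open>u\<close>. On each of them the change of variables \<open>t = u x\<close> turns the integral of
  \<open>|u'|\<close> into an integral over the levels, and there \<open>weight_at_hits\<close> compares the weights.
\<close>

lemma hits_integral:
  assumes W: "W \<in> borel_measurable borel" "\<And>t. 0 \<le> W t" "\<And>t. W t \<le> K"
  shows "2 * (\<integral>\<^sup>+t\<in>{0..u z}. ennreal (W t * a (m t / 2) t) \<partial>lebesgue) \<le>
    (\<integral>\<^sup>+x\<in>{-1..1}. ennreal (\<bar>deriv u x\<bar> * (W (u x) * a x (u x))) \<partial>lebesgue)"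
proof -
  note [measurable] = W(1)
  have K: "0 \<le> K" using W(2,3)[of 0] by linarith
  obtain S1 where S1: "S1 \<in> sets lebesgue" "S1 \<subseteq> records u (-1) 1" "\<And>x. x \<in> S1 \<Longrightarrow> u differentiable at x"
    "AE t in lebesgue. t \<in> {0..u z} \<longrightarrow> t \<in> u ` S1" by (rule regular_first_hits) blast
  obtain S2 where S2: "S2 \<in> sets lebesgue" "S2 \<subseteq> uminus ` records (\<lambda>x. u (- x)) (-1) 1"
    "\<And>x. x \<in> S2 \<Longrightarrow> u differentiable at x" "AE t in lebesgue. t \<in> {0..u z} \<longrightarrow> t \<in> u ` S2"
    by (rule regular_last_hits) blast
  have S1': "x \<in> {-1..1}" "first_hit (u x) = x" if "x \<in> S1" for x
    using S1(2) that first_hit_record[of x] unfolding records_def by auto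
  have S2': "x \<in> {-1..1}" "last_hit (u x) = x" if "x \<in> S2" for x
    using S2(2) that last_hit_record[of x] unfolding records_def by auto
  have bnd: "bounded (u ` T)" if "T \<subseteq> {-1..1}" for T
    using bounded_subset[OF compact_imp_bounded[OF compact_continuous_image[OF cont]] image_mono[OF that]] by simp
  define f1 where "f1 = (\<lambda>t. W t * a (first_hit t) t)"
  define f2 where "f2 = (\<lambda>t. W t * a (last_hit t) t)"
  have f: "f1 \<in> borel_measurable borel" "f2 \<in> borel_measurable borel"
    "0 \<le> f1 t" "0 \<le> f2 t" "f1 t \<le> K * B" "f2 t \<le> K * B" for t
    unfolding f1_def f2_def using W a_bounds K by (auto intro!: mult_mono)
  let ?h = "\<lambda>x. ennreal (\<bar>deriv u x\<bar> * (W (u x) * a x (u x)))"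
  have i1: "(\<integral>\<^sup>+t\<in>{0..u z}. ennreal (f1 t) \<partial>lebesgue) \<le> (\<integral>\<^sup>+x\<in>S1. ?h x \<partial>lebesgue)"
  proof -
    have "(\<integral>\<^sup>+t\<in>{0..u z}. ennreal (f1 t) \<partial>lebesgue) \<le> (\<integral>\<^sup>+x\<in>S1. ennreal (\<bar>deriv u x\<bar> * f1 (u x)) \<partial>lebesgue)"
      by (rule nn_integral_covered_by_image[OF S1(1,3) _ _ S1(4) f(1,3,5)])
        (use S1' in \<open>auto intro!: bnd inj_on_inverseI[of _ first_hit]\<close>)
    also have "\<dots> = (\<integral>\<^sup>+x\<in>S1. ?h x \<partial>lebesgue)"
      by (rule nn_integral_cong) (auto simp: indicator_def f1_def S1')
    finally show ?thesis .
  qed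
  have i2: "(\<integral>\<^sup>+t\<in>{0..u z}. ennreal (f2 t) \<partial>lebesgue) \<le> (\<integral>\<^sup>+x\<in>S2. ?h x \<partial>lebesgue)"
  proof -
    have "(\<integral>\<^sup>+t\<in>{0..u z}. ennreal (f2 t) \<partial>lebesgue) \<le> (\<integral>\<^sup>+x\<in>S2. ennreal (\<bar>deriv u x\<bar> * f2 (u x)) \<partial>lebesgue)"
      by (rule nn_integral_covered_by_image[OF S2(1,3) _ _ S2(4) f(2,4,6)])
        (use S2' in \<open>auto intro!: bnd inj_on_inverseI[of _ last_hit]\<close>)
    also have "\<dots> = (\<integral>\<^sup>+x\<in>S2. ?h x \<partial>lebesgue)"
      by (rule nn_integral_cong) (auto simp: indicator_def f2_def S2')
    finally show ?thesis .
  qed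
  have overlap: "S1 \<inter> S2 \<in> null_sets lebesgue"
  proof -
    have "x = y" if "x \<in> S1 \<inter> S2" "y \<in> S1 \<inter> S2" for x y
    proof -
      have lt: "\<not> x < y" if "x \<in> S1 \<inter> S2" "y \<in> S1 \<inter> S2" for x y
      proof
        assume "x < y"
        then have "u x < u y" using that S1(2) S1' unfolding records_def by auto
        moreover have "- x \<in> records (\<lambda>x. u (- x)) (-1) 1" using that S2(2) by auto
        then have "\<forall>w\<in>{-1..<-x}. u (- w) < u x" unfolding records_def by simp
        moreover have "- y \<in> {-1..<-x}" using \<open>x < y\<close> S1'(1)[of y] that by auto
        ultimately have "u (- (- y)) < u x" by blast
        with \<open>u x < u y\<close> show False by simp
      qed
      show ?thesis using lt[OF that] lt[OF that(2,1)] by simp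
    qed
    then have "\<exists>w. S1 \<inter> S2 \<subseteq> {w}" by blast
    then have "finite (S1 \<inter> S2)" using finite_subset by blast
    then show ?thesis by (intro null_sets_completionI finite_imp_null_set_lborel)
  qed
  define h' where "h' = (\<lambda>x. ennreal (\<bar>du x\<bar> * (W (u_ext x) * a x (u_ext x))))"
  have [measurable]: "h' \<in> borel_measurable lebesgue"
    unfolding h'_def by (rule measurable_completion) simp
  have cong: "(\<integral>\<^sup>+x\<in>T. ?h x \<partial>lebesgue) = (\<integral>\<^sup>+x\<in>T. h' x \<partial>lebesgue)" if "T \<subseteq> {-1..1}" for T
    by (rule nn_integral_cong_AE, rule AE_mp[OF deriv_ae])
      (use that in \<open>auto simp: indicator_def h'_def u_ext_eq subset_iff\<close>)
  note [measurable] = S1(1) S2(1) f(1,2)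
  have "2 * (\<integral>\<^sup>+t\<in>{0..u z}. ennreal (W t * a (m t / 2) t) \<partial>lebesgue) =
      (\<integral>\<^sup>+t. 2 * (ennreal (W t * a (m t / 2) t) * indicator {0..u z} t) \<partial>lborel)"
    by (simp add: nn_integral_cmult nn_integral_completion)
  also have "\<dots> \<le> (\<integral>\<^sup>+t. ennreal (f1 t) * indicator {0..u z} t + ennreal (f2 t) * indicator {0..u z} t \<partial>lborel)"
  proof (rule nn_integral_mono)
    fix t
    show "2 * (ennreal (W t * a (m t / 2) t) * indicator {0..u z} t) \<le>
        ennreal (f1 t) * indicator {0..u z} t + ennreal (f2 t) * indicator {0..u z} t"
    proof (cases "t \<in> {0..u z}")
      case True
      have "2 * ennreal (W t * a (m t / 2) t) = ennreal (2 * (W t * a (m t / 2) t))"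
        using W(2) a_bounds(1) by (subst ennreal_mult) auto
      also have "2 * (W t * a (m t / 2) t) = W t * (2 * a (m t / 2) t)" by simp
      also have "ennreal \<dots> \<le> ennreal (W t * (a (first_hit t) t + a (last_hit t) t))"
        using weight_at_hits[of t] True W(2) by (intro ennreal_leI mult_left_mono) auto
      also have "\<dots> = ennreal (f1 t) + ennreal (f2 t)"
        using f(3,4) by (simp add: f1_def f2_def algebra_simps flip: ennreal_plus)
      finally show ?thesis using True by simp
    qed simp
  qed
  also have "\<dots> = (\<integral>\<^sup>+t\<in>{0..u z}. ennreal (f1 t) \<partial>lebesgue) + (\<integral>\<^sup>+t\<in>{0..u z}. ennreal (f2 t) \<partial>lebesgue)"
    by (subst nn_integral_add) (auto simp: nn_integral_completion)
  also have "\<dots> \<le> (\<integral>\<^sup>+x\<in>S1. h' x \<partial>lebesgue) + (\<integral>\<^sup>+x\<in>S2. h' x \<partial>lebesgue)"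
    using add_mono[OF i1 i2] cong[of S1] cong[of S2] S1'(1) S2'(1) by (simp add: subset_iff)
  also have "\<dots> = (\<integral>\<^sup>+x. h' x * indicator S1 x + h' x * indicator S2 x \<partial>lebesgue)"
    by (rule nn_integral_add[symmetric]) auto
  also have "\<dots> \<le> (\<integral>\<^sup>+x\<in>{-1..1}. h' x \<partial>lebesgue)"
    by (rule nn_integral_mono_AE, rule AE_mp[OF AE_not_in[OF overlap]])
      (use S1'(1) S2'(1) in \<open>auto simp: indicator_def\<close>)
  also have "\<dots> = (\<integral>\<^sup>+x\<in>{-1..1}. ?h x \<partial>lebesgue)" by (rule cong[symmetric]) simp
  finally show ?thesis .
qed

text \<open>
  The theorem for integrands \<open>W s * p\<close> that are linear in the gradient: by equimeasurability and
  \<open>slope_ae\<close>, the left-hand side is the corresponding integral for \<open>v\<close>.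
\<close>

lemma linear_comparison:
  assumes W: "W \<in> borel_measurable borel" "\<And>t. 0 \<le> W t" "\<And>t. W t \<le> K"
  shows "(\<integral>\<^sup>+x\<in>{-1..1}. ennreal (W (u x) * (a (m (u x) / 2) (u x) * slope (u x))) \<partial>lebesgue) \<le>
    (\<integral>\<^sup>+x\<in>{-1..1}. ennreal (W (u x) * (a x (u x) * \<bar>deriv u x\<bar>)) \<partial>lebesgue)"
proof -
  note [measurable] = W(1)
  have K: "0 \<le> K" using W(2,3)[of 0] by linarith
  have "(\<integral>\<^sup>+x\<in>{-1..1}. ennreal (slope (u x) * (W (u x) * a (m (u x) / 2) (u x))) \<partial>lebesgue) \<le>
      2 * (\<integral>\<^sup>+t\<in>{0..u z}. ennreal (W t * a (m t / 2) t) \<partial>lebesgue)"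
  proof (rule slope_integral)
    show "(\<lambda>t. W t * a (m t / 2) t) \<in> borel_measurable borel" by measurable
    show "0 \<le> W t * a (m t / 2) t" "W t * a (m t / 2) t \<le> K * B" for t
      using W a_bounds K by (auto intro!: mult_mono)
  qed
  also have "\<dots> \<le> (\<integral>\<^sup>+x\<in>{-1..1}. ennreal (\<bar>deriv u x\<bar> * (W (u x) * a x (u x))) \<partial>lebesgue)"
    by (rule hits_integral[OF W])
  finally show ?thesis by (simp add: mult.commute mult.left_commute)
qed

end

section \<open>Comparison of energies\<close>

lemma convex_on_eq_on:
  assumes "convex_on A g" "\<And>x. x \<in> A \<Longrightarrow> f x = g x"
  shows "convex_on A f"
  using assms convexD[of A] unfolding convex_on_def by simp

context weighted_profile
begin

text \<open>
  Let \<open>P t\<close> be the value of \<open>a |v'|\<close> on the level \<open>t\<close> of the rearrangement and \<open>\<lambda> t\<close> a subgradient of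
  \<open>F t\<close> at \<open>P t\<close>. Then \<open>F t p \<ge> F t (P t) + \<lambda> t * (p - P t)\<close>. With \<open>t = u x\<close> and
  \<open>p = a x (u x) * |u' x|\<close>, the integral of the first term on the right is the energy of the rearrangement,
  by equimeasurability, and the integral of the second is non-negative by \<open>linear_comparison\<close>.
  To give the difference a meaning, the levels are first restricted to the set where \<open>\<lambda>\<close> and \<open>\<lambda> P\<close>
  are at most \<open>k\<close>; then \<open>k\<close> tends to infinity.
\<close>

lemma energy_comparison:
  fixes F :: "real \<Rightarrow> real \<Rightarrow> real"
  assumes F_cont: "continuous_on UNIV (\<lambda>p. F (fst p) (snd p))" and F_nonneg: "\<And>s p. 0 \<le> F s p"
    and F_convex: "\<And>s. convex_on {0..} (F s)" and F_mono: "\<And>s. mono_on {0..} (F s)"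
  shows "energy F a v \<le> energy F a u"
proof -
  have F_borel [measurable (raw)]: "(\<lambda>x. F (f x) (g x)) \<in> borel_measurable M"
    if "f \<in> borel_measurable M" "g \<in> borel_measurable M" for f g and M :: "real measure"
    using borel_measurable_continuous_Pair[OF that F_cont] .
  define P where "P = (\<lambda>t. a (m t / 2) t * slope t)"
  have P [measurable]: "P \<in> borel_measurable borel" unfolding P_def by measurable
  have P0: "0 \<le> P t" for t unfolding P_def using a_bounds slope_nonneg by simp
  \<comment> \<open>The value \<open>0\<close> at \<open>P t = 0\<close> is a subgradient of \<open>F t\<close> on the half-line since \<open>F t\<close> is increasing.\<close>
  define lam where "lam = (\<lambda>t. if P t = 0 then 0 else left_slope (F t) (P t))"
  have [measurable]: "lam \<in> borel_measurable borel" unfolding lam_def left_slope_def by measurable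
  have lam0: "0 \<le> lam t" for t
    unfolding lam_def using left_slope_subgradient(1)[OF F_convex F_mono, of "P t"] P0[of t] by auto
  have tangent: "F t (P t) + lam t * p \<le> F t p + lam t * P t" if "0 \<le> p" for t p
  proof (cases "P t = 0")
    case True
    then show ?thesis using mono_onD[OF F_mono, of 0 p t] that unfolding lam_def by simp
  next
    case False
    then have "F t (P t) + left_slope (F t) (P t) * (p - P t) \<le> F t p"
      using left_slope_subgradient(2)[OF F_convex F_mono _ that, of "P t"] P0[of t] by simp
    then show ?thesis using False unfolding lam_def by (simp add: algebra_simps)
  qed
  \<comment> \<open>On \<open>T k\<close> the weight is bounded, as the change of variables requires, and the subtracted integral is finite.\<close>
  define T where "T = (\<lambda>k::nat. {t. lam t \<le> real k \<and> lam t * P t \<le> real k})"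
  have T [measurable]: "T k \<in> sets borel" for k unfolding T_def by measurable
  define p where "p = (\<lambda>x. a x (u_ext x) * \<bar>du x\<bar>)"
  have [measurable]: "p \<in> borel_measurable borel" unfolding p_def by measurable
  have p0: "0 \<le> p x" for x unfolding p_def using a_bounds by simp
  have energy_u: "energy F a u = (\<integral>\<^sup>+x\<in>{-1..1}. ennreal (F (u_ext x) (p x)) \<partial>lborel)"
    unfolding energy_def nn_integral_completion[where M = lborel, symmetric]
    by (rule nn_integral_cong_AE, rule AE_mp[OF deriv_ae]) (auto simp: indicator_def p_def u_ext_eq)
  have truncated: "(\<integral>\<^sup>+x\<in>{-1..1}. ennreal (F (v x) (P (v x))) * indicator (T k) (v x) \<partial>lebesgue) \<le> energy F a u" for k
  proof -
    define W where "W = (\<lambda>t. lam t * indicator (T k) t)"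
    have W [measurable]: "W \<in> borel_measurable borel" unfolding W_def by measurable
    have W0: "0 \<le> W t" "W t \<le> real k" "W t * P t \<le> real k" for t
      using lam0[of t] unfolding W_def T_def by (auto simp: indicator_def)
    define Y where "Y = (\<integral>\<^sup>+x\<in>{-1..1}. ennreal (W (u_ext x) * P (u_ext x)) \<partial>lborel)"
    define V where "V = (\<integral>\<^sup>+x\<in>{-1..1}. ennreal (W (u_ext x) * p x) \<partial>lborel)"
    define Z where "Z = (\<integral>\<^sup>+x\<in>{-1..1}. ennreal (F (u_ext x) (P (u_ext x))) * indicator (T k) (u_ext x) \<partial>lborel)"
    have Y: "Y = (\<integral>\<^sup>+x\<in>{-1..1}. ennreal (W (u x) * (a (m (u x) / 2) (u x) * slope (u x))) \<partial>lebesgue)"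
      unfolding Y_def nn_integral_completion[where M = lborel, symmetric]
      by (rule nn_integral_cong) (auto simp: indicator_def u_ext_eq P_def)
    have V: "V = (\<integral>\<^sup>+x\<in>{-1..1}. ennreal (W (u x) * (a x (u x) * \<bar>deriv u x\<bar>)) \<partial>lebesgue)"
      unfolding V_def nn_integral_completion[where M = lborel, symmetric]
      by (rule nn_integral_cong_AE, rule AE_mp[OF deriv_ae]) (auto simp: indicator_def p_def u_ext_eq)
    have "Y \<le> V" unfolding Y V by (rule linear_comparison[OF W W0(1,2)])
    have "Y \<le> (\<integral>\<^sup>+x. ennreal (real k) * indicator {-1..1::real} x \<partial>lborel)"
      unfolding Y_def by (rule nn_integral_mono) (use W0(3) in \<open>auto simp: indicator_def intro!: ennreal_leI\<close>)
    also have "\<dots> = ennreal (real k) * 2" by (subst nn_integral_cmult_indicator) auto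
    also have "\<dots> < \<infinity>" by (simp add: ennreal_mult_less_top)
    finally have "Y \<noteq> \<infinity>" by simp
    \<comment> \<open>The tangent inequality with both negative terms moved to the other side, so that it can be integrated in \<open>[0,\<infinity>]\<close>.\<close>
    have "Z + V = (\<integral>\<^sup>+x. ennreal (F (u_ext x) (P (u_ext x))) * indicator (T k) (u_ext x) * indicator {-1..1} x +
        ennreal (W (u_ext x) * p x) * indicator {-1..1} x \<partial>lborel)"
      unfolding Z_def V_def by (rule nn_integral_add[symmetric]) auto
    also have "\<dots> \<le> (\<integral>\<^sup>+x. ennreal (F (u_ext x) (p x)) * indicator {-1..1} x +
        ennreal (W (u_ext x) * P (u_ext x)) * indicator {-1..1} x \<partial>lborel)"
    proof (rule nn_integral_mono)
      fix x
      have "ennreal (F (u_ext x) (P (u_ext x))) * indicator (T k) (u_ext x) + ennreal (W (u_ext x) * p x) \<le>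
          ennreal (F (u_ext x) (p x)) + ennreal (W (u_ext x) * P (u_ext x))"
      proof (cases "u_ext x \<in> T k")
        case True
        then show ?thesis
          using tangent[OF p0[of x], of "u_ext x"] F_nonneg W0(1) p0[of x] P0 lam0
          by (simp add: W_def flip: ennreal_plus)
      qed (simp add: W_def)
      then show "ennreal (F (u_ext x) (P (u_ext x))) * indicator (T k) (u_ext x) * indicator {-1..1} x +
          ennreal (W (u_ext x) * p x) * indicator {-1..1} x \<le>
          ennreal (F (u_ext x) (p x)) * indicator {-1..1} x +
          ennreal (W (u_ext x) * P (u_ext x)) * indicator {-1..1} x"
        by (auto simp: indicator_def)
    qed
    also have "\<dots> = energy F a u + Y"
      unfolding energy_u Y_def by (rule nn_integral_add) auto
    finally have "Z + V \<le> energy F a u + Y" .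
    with add_left_mono[OF \<open>Y \<le> V\<close>, of Z] have "Z + Y \<le> energy F a u + Y" by (rule order_trans)
    then have "Y + Z \<le> Y + energy F a u" by (simp add: add.commute)
    then have "Z \<le> energy F a u"
      using \<open>Y \<noteq> \<infinity>\<close> by (simp add: ennreal_add_left_cancel_le)
    moreover have "Z = (\<integral>\<^sup>+x\<in>{-1..1}. ennreal (F (u x) (P (u x))) * indicator (T k) (u x) \<partial>lebesgue)"
      unfolding Z_def nn_integral_completion[where M = lborel, symmetric]
      by (rule nn_integral_cong) (auto simp: indicator_def u_ext_eq)
    moreover have "\<dots> = (\<integral>\<^sup>+x\<in>{-1..1}. ennreal (F (v x) (P (v x))) * indicator (T k) (v x) \<partial>lebesgue)"
      by (rule equimeasurable[of "\<lambda>t. ennreal (F t (P t)) * indicator (T k) t"]) measurable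
    ultimately show ?thesis by simp
  qed
  define g where "g = (\<lambda>k x. ennreal (F (v x) (P (v x))) * indicator (T k) (v x) * indicator {-1..1} x)"
  have "energy F a v = (\<integral>\<^sup>+x\<in>{-1..1}. ennreal (F (v x) (P (v x))) \<partial>lebesgue)"
    unfolding energy_def
  proof (rule nn_integral_cong_AE, rule AE_mp[OF slope_ae], intro AE_I2 impI)
    fix x
    assume x: "x \<in> {-1..1} \<longrightarrow> \<bar>deriv v x\<bar> = slope (v x) \<and> (slope (v x) \<noteq> 0 \<longrightarrow> m (v x) / 2 = \<bar>x\<bar>)"
    have "a x (v x) * \<bar>deriv v x\<bar> = P (v x)" if "x \<in> {-1..1}"
      using x that a_even[of x "v x"] unfolding P_def by (cases "slope (v x) = 0") (auto simp: abs_if)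
    then show "ennreal (F (v x) (a x (v x) * \<bar>deriv v x\<bar>)) * indicator {-1..1} x =
        ennreal (F (v x) (P (v x))) * indicator {-1..1} x"
      by (auto simp: indicator_def)
  qed
  also have "\<dots> \<le> (\<integral>\<^sup>+x. (SUP k. g k x) \<partial>lebesgue)"
  proof (rule nn_integral_mono)
    fix x
    obtain k where k: "max (lam (v x)) (lam (v x) * P (v x)) \<le> real k" using real_arch_simple by blast
    then have "ennreal (F (v x) (P (v x))) * indicator {-1..1} x = g k x"
      unfolding g_def T_def by simp
    then show "ennreal (F (v x) (P (v x))) * indicator {-1..1} x \<le> (SUP k. g k x)"
      by (metis SUP_upper UNIV_I)
  qed
  also have "\<dots> = (SUP k. \<integral>\<^sup>+x. g k x \<partial>lebesgue)"
  proof (rule nn_integral_monotone_convergence_SUP)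
    show "incseq g"
    proof (intro monoI le_funI)
      fix i j :: nat and x assume "i \<le> j"
      then have "T i \<subseteq> T j" unfolding T_def by auto
      then show "g i x \<le> g j x" unfolding g_def by (auto simp: indicator_def)
    qed
    show "g k \<in> borel_measurable lebesgue" for k
      unfolding g_def by (rule measurable_completion) simp
  qed
  also have "\<dots> \<le> energy F a u"
    by (rule SUP_least) (use truncated in \<open>simp add: g_def\<close>)
  finally show ?thesis .
qed

end

theorem theorem5:
  fixes F a :: "real \<Rightarrow> real \<Rightarrow> real" and u :: "real \<Rightarrow> real"
  assumes "F \<in> integrand_class"
    and "u \<in> W11"
    and "\<forall>x\<in>{-1..1}. u x \<ge> 0"
    and "u (-1) = 0" and "u 1 = 0"
    and "weight a"
    and "\<forall>t\<ge>0. \<forall>x\<in>{-1..1}. a (-x) t = a x t"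
    and "\<forall>t\<ge>0. convex_on {-1..1} (\<lambda>x. a x t)"
  shows "energy F a (sym_rearr u) \<le> energy F a u"
proof -
  have ac: "abs_cont_on {-1..1} u" using assms(2) unfolding W11_def by simp
  then have cont: "continuous_on {-1..1} u" by (rule abs_cont_on_imp_continuous)
  have "\<exists>z\<in>{-1..1}. \<forall>x\<in>{-1..1}. u x \<le> u z"
    by (rule continuous_attains_sup[OF _ _ cont]) auto
  then obtain z where z: "z \<in> {-1..1}" "\<And>x. x \<in> {-1..1} \<Longrightarrow> u x \<le> u z" by blast
  have M: "0 \<le> u z" using assms(3) z(1) by blast
  \<comment> \<open>Both energies only see \<open>a\<close> on \<open>[-1,1] \<times> [0,u z]\<close> and \<open>F\<close> on the quadrant, so both may be extended by projections.\<close>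
  define c where "c = (\<lambda>x::real. max (-1) (min 1 x))"
  define d where "d = (\<lambda>t. max 0 (min (u z) t))"
  define a' where "a' = (\<lambda>x t. a (c x) (d t))"
  define F' where "F' = (\<lambda>s p. F (max 0 s) (max 0 p))"
  have c: "c x \<in> {-1..1}" "x \<in> {-1..1} \<Longrightarrow> c x = x" for x unfolding c_def by auto
  have d: "d t \<in> {0..u z}" "t \<in> {0..u z} \<Longrightarrow> d t = t" for t using M unfolding d_def by auto
  have a_cont: "continuous_on ({-1..1} \<times> {0..}) (\<lambda>(x, t). a x t)"
    and a_nonneg: "\<And>x t. x \<in> {-1..1} \<Longrightarrow> 0 \<le> t \<Longrightarrow> 0 \<le> a x t"
    using assms(6) unfolding weight_def by auto
  have "compact ((\<lambda>(x, t). a x t) ` ({-1..1} \<times> {0..u z}))"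
    by (intro compact_continuous_image continuous_on_subset[OF a_cont] compact_Times) auto
  then have "bdd_above ((\<lambda>(x, t). a x t) ` ({-1..1} \<times> {0..u z}))"
    by (intro bounded_imp_bdd_above compact_imp_bounded)
  then obtain B where "\<forall>y\<in>(\<lambda>(x, t). a x t) ` ({-1..1} \<times> {0..u z}). y \<le> B"
    unfolding bdd_above_def by blast
  then have B: "a x t \<le> B" if "x \<in> {-1..1}" "t \<in> {0..u z}" for x t using that by force
  interpret weighted_profile u z a' B
  proof
    show "u x \<ge> 0" if "x \<in> {-1..1}" for x using assms(3) that by blast
    have "continuous_on UNIV (\<lambda>p. (\<lambda>(x, t). a x t) (c (fst p), d (snd p)))"
      by (rule continuous_on_compose2[OF a_cont]) (use c(1) d(1) in \<open>auto simp: c_def d_def intro!: continuous_intros\<close>)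
    then show "continuous_on UNIV (\<lambda>p. a' (fst p) (snd p))" unfolding a'_def by simp
    show "0 \<le> a' x t" for x t unfolding a'_def using a_nonneg[OF c(1)] d(1)[of t] by simp
    show "a' x t \<le> B" for x t unfolding a'_def by (rule B[OF c(1) d(1)])
    show "a' (- x) t = a' x t" if "x \<in> {-1..1}" for x t
      using assms(7) d(1)[of t] that c(2)[of x] c(2)[of "-x"] unfolding a'_def by auto
    have "convex_on {-1..1} (\<lambda>x. a x (d t))" for t using assms(8) d(1)[of t] by simp
    then show "convex_on {-1..1} (\<lambda>x. a' x t)" for t
      unfolding a'_def by (rule convex_on_eq_on) (simp add: c(2))
  qed (use cont assms(4,5) z ac in auto)
  have F_cont: "continuous_on ({0..} \<times> {0..}) (\<lambda>(s, p). F s p)"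
    and F_props: "\<And>s p. 0 \<le> s \<Longrightarrow> 0 \<le> p \<Longrightarrow> 0 \<le> F s p" "\<And>s. 0 \<le> s \<Longrightarrow> convex_on {0..} (F s)"
      "\<And>s. 0 \<le> s \<Longrightarrow> strict_mono_on {0..} (F s)"
    using assms(1) unfolding integrand_class_def by auto
  have main: "energy F' a' (sym_rearr u) \<le> energy F' a' u"
  proof (rule energy_comparison)
    have "continuous_on UNIV (\<lambda>p. (\<lambda>(s, p). F s p) (max 0 (fst p), max 0 (snd p)))"
      by (rule continuous_on_compose2[OF F_cont]) (auto intro!: continuous_intros)
    then show "continuous_on UNIV (\<lambda>p. F' (fst p) (snd p))" unfolding F'_def by simp
    show "0 \<le> F' s p" for s p unfolding F'_def using F_props(1) by simp
    show "convex_on {0..} (F' s)" for s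
      unfolding F'_def using F_props(2)[of "max 0 s"]
      by (rule_tac convex_on_eq_on) auto
    show "mono_on {0..} (F' s)" for s
      using strict_mono_on_leD[OF F_props(3)[of "max 0 s"]] unfolding F'_def mono_on_def by simp
  qed
  have same: "energy F' a' w = energy F a w" if "\<And>x. x \<in> {-1..1} \<Longrightarrow> w x \<in> {0..u z}" for w
    unfolding energy_def
  proof (rule nn_integral_cong)
    fix x
    show "ennreal (F' (w x) (a' x (w x) * \<bar>deriv w x\<bar>)) * indicator {-1..1} x =
        ennreal (F (w x) (a x (w x) * \<bar>deriv w x\<bar>)) * indicator {-1..1} x"
    proof (cases "x \<in> {-1..1}")
      case True
      then show ?thesis
        using that[OF True] c(2)[OF True] d(2)[OF that[OF True]] a_nonneg[OF True, of "w x"]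
        unfolding F'_def a'_def by (simp add: max_absorb2)
    qed simp
  qed
  have "energy F a (sym_rearr u) = energy F' a' (sym_rearr u)"
    by (rule same[symmetric]) (use v_nonneg v_le_peak in auto)
  also have "\<dots> \<le> energy F' a' u" by (rule main)
  also have "\<dots> = energy F a u"
    by (rule same) (use assms(3) z in auto)
  finally show ?thesis .
qed

end
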